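(* Let $\rho_1,\rho_2:W_F\to\mathrm{GL}_2(\overline{\mathbb{Q}}_\ell)$ be two special representations such that $\rho_1(W_F),\rho_2(W_F)\subset\mathrm{GL}_2(\mathcal{O}_K)$, with associated Weil--Deligne representations $\chi\omega\oplus\chi$ and $\theta\omega\oplus\theta$, respectively, where $\chi,\theta$ are $1$-dimensional representations of $W_F$. Suppose (as may be assumed without loss of generality) that there are upper triangular matrices $U_j=\begin{pmatrix}a_j&b_j\\0&d_j\end{pmatrix}\in\mathrm{GL}_2(K)$, $j=1,2$, such that for all $k\in\mathbb{Z}$, $\tau\in I_F$, $$\rho_1(\Phi^k\tau)=\begin{pmatrix}\chi\omega(\Phi^k\tau)&\frac{a_1}{d_1}t_\ell(\tau)\chi\omega(\Phi^k\tau)+\frac{b_1}{d_1}(\chi(\Phi^k\tau)-\chi\omega(\Phi^k\tau))\\0&\chi(\Phi^k\tau)\end{pmatrix},$$ $$\rho_2(\Phi^k\tau)=\begin{pmatrix}\theta\omega(\Phi^k\tau)&\frac{a_2}{d_2}t_\ell(\tau)\theta\omega(\Phi^k\tau)+\frac{b_2}{d_2}(\theta(\Phi^k\tau)-\theta\omega(\Phi^k\tau))\\0&\theta(\Phi^k\tau)\end{pmatrix}.$$ Suppose that $a_1/d_1,\,a_2/d_2\in\mathcal{O}_K^\times$. Then $\overline{\rho}_1\cong\overline{\rho}_2$ if and only if $\overline{\chi}=\overline{\theta}$ and $$v\left(\frac{a_2b_1-a_1b_2}{a_1d_2}\right)\geq\min\{0,1-i\},$$ where $i$ is the maximal nonnegative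 integer such that $q\equiv1\pmod{\lambda^i}$.
   Context: $p\neq\ell$ are odd primes. $F/\mathbb{Q}_p$ is a finite extension with residue field of order $q$, Weil group $W_F$ and inertia group $I_F$. $\Phi\in W_F$ is a fixed Frobenius element, and $\omega$ is the character of $W_F$ with $\omega(\Phi^k\tau)=q^{-k}$ for $k\in\mathbb{Z}$, $\tau\in I_F$. $t_\ell:I_F\to\mathbb{Z}_\ell$ is a fixed continuous surjective homomorphism; it satisfies $t_\ell(g\tau g^{-1})=\omega(g)t_\ell(\tau)$. $K/\mathbb{Q}_\ell$ is a finite extension with ring of integers $\mathcal{O}_K$, maximal ideal $\lambda$, and normalized valuation $v$ (a uniformizer has valuation $1$, $v(0)=\infty$). A bar denotes reduction modulo $\lambda$. All representations are continuous. The Weil--Deligne representation associated with a continuous $\rho$ is $(\rho_\Phi,N_\rho)$, where $N_\rho$ is the unique nilpotent matrix with $\rho(\tau)=\exp(t_\ell(\tau)N_\rho)$ for $\tau$ in some open subgroup of $I_F$, and $\rho_\Phi(\Phi^k\tau)=\rho(\Phi^k\tau)\exp(-t_\ell(\tau)N_\rho)$. $\rho$ is called special if its Weil--Deligne representation is isomorphic to $\left(\chi\omega\oplus\chi,\begin{pmatrix}0&1\\0&0\end{pmatrix}\right)$ for some $1$-dimensional representation $\chi$ of $W_F$. *)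

theory Defs
  imports
    "HOL-Analysis.Analysis"
    "HOL-Algebra.Algebraic_Closure_Type"
    "HOL-Algebra.Ideal_Product"
begin

section \<open>Algebraic closures of \<open>p\<close>-adic fields\<close>

definition padic_abs :: "nat \<Rightarrow> rat \<Rightarrow> real" where
  "padic_abs p r = (if r = 0 then 0 else
     real p powi (int (multiplicity (int p) (snd (quotient_of r)))
                    - int (multiplicity (int p) (fst (quotient_of r)))))"

definition abs_topology :: "('a::ab_group_add \<Rightarrow> real) \<Rightarrow> 'a topology" where
  "abs_topology nrm = Metric_space.mtopology UNIV (\<lambda>x y. nrm (x - y))"

definition rat_closure :: "('a::field_char_0 \<Rightarrow> real) \<Rightarrow> 'a set" where
  "rat_closure nrm = abs_topology nrm closure_of (range of_rat)"

text \<open>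
  The type \<open>'a\<close> with the absolute value \<open>nrm\<close> is an algebraic closure of the field of \<open>p\<close>-adic
  numbers: \<open>nrm\<close> extends the \<open>p\<close>-adic absolute value of the rational numbers, the closure of the
  rational numbers is complete, that is, it is a completion of them, and every element is algebraic
  over it. Finite extensions of the \<open>p\<close>-adic numbers are subfields of \<open>'a\<close>.
\<close>

locale padic_closure =
  fixes p :: nat and nrm :: "'a::{alg_closed_field, field_char_0} \<Rightarrow> real"
  assumes prime_p: "Factorial_Ring.prime p"
    and nrm_nonneg: "nrm x \<ge> 0"
    and nrm_eq_0_iff: "nrm x = 0 \<longleftrightarrow> x = 0"
    and nrm_mult: "nrm (x * y) = nrm x * nrm y"
    and nrm_add_le_max: "nrm (x + y) \<le> max (nrm x) (nrm y)"
    and nrm_of_rat: "nrm (of_rat r) = padic_abs p r"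
    and complete: "Metric_space.mcomplete (rat_closure nrm) (\<lambda>x y. nrm (x - y))"
    and algebraic: "\<exists>P. P \<noteq> 0 \<and> (\<forall>i. poly.coeff P i \<in> rat_closure nrm) \<and> poly P x = 0"

definition finite_padic_extension ::
    "('a::{alg_closed_field, field_char_0} \<Rightarrow> real) \<Rightarrow> 'a set \<Rightarrow> bool" where
  "finite_padic_extension nrm L \<longleftrightarrow>
     subfield L ring_of_type_algebra \<and> rat_closure nrm \<subseteq> L \<and>
     ring.finite_dimension ring_of_type_algebra (rat_closure nrm) L"

definition int_ring :: "('a::field \<Rightarrow> real) \<Rightarrow> 'a set \<Rightarrow> 'a ring" where
  "int_ring nrm L = ring_of_type_algebra\<lparr>carrier := {x \<in> L. nrm x \<le> 1}\<rparr>"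

definition max_ideal :: "('a::field \<Rightarrow> real) \<Rightarrow> 'a set \<Rightarrow> 'a set" where
  "max_ideal nrm L = {x \<in> L. nrm x < 1}"

definition residue_ring :: "('a::field \<Rightarrow> real) \<Rightarrow> 'a set \<Rightarrow> 'a set ring" where
  "residue_ring nrm L = int_ring nrm L Quot max_ideal nrm L"

definition reduction :: "('a::field \<Rightarrow> real) \<Rightarrow> 'a set \<Rightarrow> 'a \<Rightarrow> 'a set" where
  "reduction nrm L x = max_ideal nrm L +>\<^bsub>int_ring nrm L\<^esub> x"

definition max_ideal_power :: "('a::field \<Rightarrow> real) \<Rightarrow> 'a set \<Rightarrow> nat \<Rightarrow> 'a set" where
  "max_ideal_power nrm L i = max_ideal nrm L [^]\<^bsub>ideals_set (int_ring nrm L)\<^esub> i"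

text \<open>Surjectivity of \<open>v\<close> onto the integers is the normalization; values outside \<open>L\<close> are irrelevant.\<close>

definition normalized_valuation ::
    "('a::field \<Rightarrow> real) \<Rightarrow> 'a set \<Rightarrow> ('a \<Rightarrow> ereal) \<Rightarrow> bool" where
  "normalized_valuation nrm L v \<longleftrightarrow>
     v 0 = \<infinity> \<and> v ` (L - {0}) = range (\<lambda>n::int. ereal (of_int n)) \<and>
     (\<forall>x\<in>L. \<forall>y\<in>L. v (x * y) = v x + v y) \<and>
     (\<forall>x\<in>L. \<forall>y\<in>L. v (x + y) \<ge> min (v x) (v y)) \<and>
     carrier (int_ring nrm L) = {x \<in> L. v x \<ge> 0}"

section \<open>The Weil group\<close>

definition galois_set :: "'a::field set \<Rightarrow> ('a \<Rightarrow> 'a) set" where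
  "galois_set L = {\<sigma> \<in> ring_iso ring_of_type_algebra ring_of_type_algebra. \<forall>x\<in>L. \<sigma> x = x}"

definition residue_card :: "('a::field \<Rightarrow> real) \<Rightarrow> 'a set \<Rightarrow> nat" where
  "residue_card nrm L = order (residue_ring nrm L)"

text \<open>
  \<open>\<sigma>\<close> acts on the residue field of the algebraic closure as the \<open>n\<close>-th power of the arithmetic
  Frobenius automorphism, which sends \<open>x\<close> to \<open>x ^ q\<close>.
\<close>

definition acts_as_frobenius_power ::
    "('a::field \<Rightarrow> real) \<Rightarrow> 'a set \<Rightarrow> int \<Rightarrow> ('a \<Rightarrow> 'a) \<Rightarrow> bool" where
  "acts_as_frobenius_power nrm L n \<sigma> \<longleftrightarrow>
     (\<forall>x. nrm x \<le> 1 \<longrightarrow>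
        (if n \<ge> 0 then nrm (\<sigma> x - x ^ (residue_card nrm L ^ nat n)) < 1
         else nrm (\<sigma> x ^ (residue_card nrm L ^ nat (- n)) - x) < 1))"

definition weil_group :: "('a::field \<Rightarrow> real) \<Rightarrow> 'a set \<Rightarrow> ('a \<Rightarrow> 'a) monoid" where
  "weil_group nrm L =
     \<lparr>carrier = {\<sigma> \<in> galois_set L. \<exists>n. acts_as_frobenius_power nrm L n \<sigma>},
      monoid.mult = (\<circ>), one = id\<rparr>"

definition inertia :: "('a::field \<Rightarrow> real) \<Rightarrow> 'a set \<Rightarrow> ('a \<Rightarrow> 'a) set" where
  "inertia nrm L = {\<sigma> \<in> galois_set L. acts_as_frobenius_power nrm L 0 \<sigma>}"

text \<open>
  The normalization of the character \<open>\<omega>\<close> and the relation \<open>t (g \<tau> g\<^sup>-\<^sup>1) = \<omega> g * t \<tau>\<close> force the chosen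
  Frobenius element to be a geometric one.
\<close>

definition frobenius_element :: "('a::field \<Rightarrow> real) \<Rightarrow> 'a set \<Rightarrow> ('a \<Rightarrow> 'a) \<Rightarrow> bool" where
  "frobenius_element nrm L \<Phi> \<longleftrightarrow>
     \<Phi> \<in> carrier (weil_group nrm L) \<and> acts_as_frobenius_power nrm L (- 1) \<Phi>"

definition krull_topology :: "'a::field set \<Rightarrow> ('a \<Rightarrow> 'a) topology" where
  "krull_topology L =
     subtopology (product_topology (\<lambda>_. discrete_topology UNIV) UNIV) (galois_set L)"

text \<open>
  The topology in which inertia is an open subgroup carrying the Krull topology; it is strictly
  finer than the subspace topology coming from the absolute Galois group.
\<close>

definition weil_topology :: "('a::field \<Rightarrow> real) \<Rightarrow> 'a set \<Rightarrow> ('a \<Rightarrow> 'a) topology" where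
  "weil_topology nrm L = topology (\<lambda>U. U \<subseteq> carrier (weil_group nrm L) \<and>
     (\<forall>\<sigma>\<in>carrier (weil_group nrm L).
        openin (subtopology (krull_topology L) (inertia nrm L)) {\<tau> \<in> inertia nrm L. \<sigma> \<circ> \<tau> \<in> U}))"

lemma openin_weil_topology:
  "openin (weil_topology nrm L) U \<longleftrightarrow> U \<subseteq> carrier (weil_group nrm L) \<and>
     (\<forall>\<sigma>\<in>carrier (weil_group nrm L).
        openin (subtopology (krull_topology L) (inertia nrm L)) {\<tau> \<in> inertia nrm L. \<sigma> \<circ> \<tau> \<in> U})"
proof -
  have "istopology (\<lambda>U. U \<subseteq> carrier (weil_group nrm L) \<and>
     (\<forall>\<sigma>\<in>carrier (weil_group nrm L).
        openin (subtopology (krull_topology L) (inertia nrm L)) {\<tau> \<in> inertia nrm L. \<sigma> \<circ> \<tau> \<in> U}))"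
    (is "istopology ?P")
  proof -
    have inter: "?P (S \<inter> T)" if "?P S" "?P T" for S T
    proof -
      have "{\<tau> \<in> inertia nrm L. \<sigma> \<circ> \<tau> \<in> S \<inter> T} =
          {\<tau> \<in> inertia nrm L. \<sigma> \<circ> \<tau> \<in> S} \<inter> {\<tau> \<in> inertia nrm L. \<sigma> \<circ> \<tau> \<in> T}" for \<sigma>
        by blast
      with that show ?thesis
        by auto
    qed
    have union: "?P (\<Union>\<K>)" if "\<forall>S\<in>\<K>. ?P S" for \<K>
    proof -
      have "{\<tau> \<in> inertia nrm L. \<sigma> \<circ> \<tau> \<in> \<Union>\<K>} = (\<Union>S\<in>\<K>. {\<tau> \<in> inertia nrm L. \<sigma> \<circ> \<tau> \<in> S})"
        for \<sigma>
        by blast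
      with that show ?thesis
        by auto
    qed
    show ?thesis
      unfolding istopology_def using inter union by blast
  qed
  thus ?thesis
    unfolding weil_topology_def by (simp add: topology_inverse')
qed

section \<open>Matrices and representations\<close>

definition mat_monoid :: "('a, 'm) ring_scheme \<Rightarrow> ('a ^ 'n ^ 'n) monoid" where
  "mat_monoid R =
     \<lparr>carrier = {A. \<forall>i j. A $ i $ j \<in> carrier R},
      monoid.mult = (\<lambda>A B. \<chi> i j. \<Oplus>\<^bsub>R\<^esub>k\<in>UNIV. A $ i $ k \<otimes>\<^bsub>R\<^esub> B $ k $ j),
      one = (\<chi> i j. if i = j then \<one>\<^bsub>R\<^esub> else \<zero>\<^bsub>R\<^esub>)\<rparr>"

definition GL :: "('a, 'm) ring_scheme \<Rightarrow> ('a ^ 'n ^ 'n) monoid" where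
  "GL R = units_of (mat_monoid R)"

definition rep_isomorphic ::
    "('g, 'm) monoid_scheme \<Rightarrow> ('a, 'r) ring_scheme \<Rightarrow>
     ('g \<Rightarrow> 'a ^ 'n ^ 'n) \<Rightarrow> ('g \<Rightarrow> 'a ^ 'n ^ 'n) \<Rightarrow> bool" where
  "rep_isomorphic G R \<rho> \<rho>' \<longleftrightarrow>
     (\<exists>P\<in>carrier (GL R). \<forall>g\<in>carrier G.
        P \<otimes>\<^bsub>mat_monoid R\<^esub> \<rho> g = \<rho>' g \<otimes>\<^bsub>mat_monoid R\<^esub> P)"

text \<open>Inversion is continuous on invertible matrices, so continuity may be tested on the entries.\<close>

definition continuous_rep ::
    "('a::field \<Rightarrow> real) \<Rightarrow> 'a set \<Rightarrow> ('b::field \<Rightarrow> real) \<Rightarrow>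
     (('a \<Rightarrow> 'a) \<Rightarrow> 'b ^ 'n ^ 'n) \<Rightarrow> bool" where
  "continuous_rep nF F nK \<rho> \<longleftrightarrow>
     \<rho> \<in> hom (weil_group nF F) (GL ring_of_type_algebra) \<and>
     (\<forall>i j. continuous_map (weil_topology nF F) (abs_topology nK) (\<lambda>g. \<rho> g $ i $ j))"

definition continuous_character ::
    "('a::field \<Rightarrow> real) \<Rightarrow> 'a set \<Rightarrow> ('b::field \<Rightarrow> real) \<Rightarrow> (('a \<Rightarrow> 'a) \<Rightarrow> 'b) \<Rightarrow> bool" where
  "continuous_character nF F nK chi \<longleftrightarrow>
     chi \<in> hom (weil_group nF F) (units_of ring_of_type_algebra) \<and>
     continuous_map (weil_topology nF F) (abs_topology nK) chi"

definition reduced_rep ::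
    "('b::field \<Rightarrow> real) \<Rightarrow> 'b set \<Rightarrow> ('g \<Rightarrow> 'b ^ 'n ^ 'n) \<Rightarrow> 'g \<Rightarrow> 'b set ^ 'n ^ 'n" where
  "reduced_rep nK K \<rho> g = (\<chi> i j. reduction nK K (\<rho> g $ i $ j))"

definition weil_omega ::
    "('a::field \<Rightarrow> real) \<Rightarrow> 'a set \<Rightarrow> ('a \<Rightarrow> 'a) \<Rightarrow> (('a \<Rightarrow> 'a) \<Rightarrow> 'b::field) \<Rightarrow> bool" where
  "weil_omega nF F \<Phi> \<omega> \<longleftrightarrow>
     \<omega> \<in> hom (weil_group nF F) (units_of ring_of_type_algebra) \<and>
     (\<forall>k::int. \<forall>\<tau>\<in>inertia nF F.
        \<omega> (\<Phi> [^]\<^bsub>weil_group nF F\<^esub> k \<otimes>\<^bsub>weil_group nF F\<^esub> \<tau>) = of_nat (residue_card nF F) powi (- k))"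

definition tame_character ::
    "('a::field \<Rightarrow> real) \<Rightarrow> 'a set \<Rightarrow> ('b::field_char_0 \<Rightarrow> real) \<Rightarrow> (('a \<Rightarrow> 'a) \<Rightarrow> 'b) \<Rightarrow>
     (('a \<Rightarrow> 'a) \<Rightarrow> 'b) \<Rightarrow> bool" where
  "tame_character nF F nK \<omega> t \<longleftrightarrow>
     t ` inertia nF F = carrier (int_ring nK (rat_closure nK)) \<and>
     (\<forall>\<sigma>\<in>inertia nF F. \<forall>\<tau>\<in>inertia nF F. t (\<sigma> \<otimes>\<^bsub>weil_group nF F\<^esub> \<tau>) = t \<sigma> + t \<tau>) \<and>
     continuous_map (subtopology (weil_topology nF F) (inertia nF F)) (abs_topology nK) t \<and>
     (\<forall>g\<in>carrier (weil_group nF F). \<forall>\<tau>\<in>inertia nF F.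
        t (g \<otimes>\<^bsub>weil_group nF F\<^esub> \<tau> \<otimes>\<^bsub>weil_group nF F\<^esub> inv\<^bsub>weil_group nF F\<^esub> g) = \<omega> g * t \<tau>)"

section \<open>Weil--Deligne representations\<close>

definition nilpotent_matrix :: "'b::field ^ 'n ^ 'n \<Rightarrow> bool" where
  "nilpotent_matrix N \<longleftrightarrow> (\<exists>m::nat. N [^]\<^bsub>mat_monoid ring_of_type_algebra\<^esub> m = 0)"

definition scale_matrix :: "'b::field \<Rightarrow> 'b ^ 'n ^ 'n \<Rightarrow> 'b ^ 'n ^ 'n" where
  "scale_matrix c A = (\<chi> i j. c * A $ i $ j)"

text \<open>
  The exponential series; for a nilpotent matrix only finitely many terms are nonzero, and the
  definition is only meaningful in this case.
\<close>

definition exp_nilpotent :: "'b::field_char_0 ^ 'n ^ 'n \<Rightarrow> 'b ^ 'n ^ 'n" where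
  "exp_nilpotent N =
     (\<Sum>m\<in>{m::nat. N [^]\<^bsub>mat_monoid ring_of_type_algebra\<^esub> m \<noteq> 0}.
        scale_matrix (1 / fact m) (N [^]\<^bsub>mat_monoid ring_of_type_algebra\<^esub> m))"

text \<open>
  \<open>(r, N)\<close> is the Weil--Deligne representation of \<open>\<rho>\<close>. It is determined by \<open>\<rho>\<close>: two nilpotent
  logarithms of \<open>\<rho>\<close> on a common open subgroup agree, as \<open>t\<close> is not zero on an open subgroup.
\<close>

definition is_weil_deligne_rep ::
    "('a::field \<Rightarrow> real) \<Rightarrow> 'a set \<Rightarrow> ('a \<Rightarrow> 'a) \<Rightarrow> (('a \<Rightarrow> 'a) \<Rightarrow> 'b::field_char_0) \<Rightarrow>
     (('a \<Rightarrow> 'a) \<Rightarrow> 'b ^ 'n ^ 'n) \<Rightarrow> (('a \<Rightarrow> 'a) \<Rightarrow> 'b ^ 'n ^ 'n) \<Rightarrow> 'b ^ 'n ^ 'n \<Rightarrow> bool" where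
  "is_weil_deligne_rep nF F \<Phi> t \<rho> r N \<longleftrightarrow>
     nilpotent_matrix N \<and>
     (\<exists>H. subgroup H (weil_group nF F) \<and> H \<subseteq> inertia nF F \<and>
          openin (subtopology (weil_topology nF F) (inertia nF F)) H \<and>
          (\<forall>\<tau>\<in>H. \<rho> \<tau> = exp_nilpotent (scale_matrix (t \<tau>) N))) \<and>
     (\<forall>k::int. \<forall>\<tau>\<in>inertia nF F.
        r (\<Phi> [^]\<^bsub>weil_group nF F\<^esub> k \<otimes>\<^bsub>weil_group nF F\<^esub> \<tau>) =
        \<rho> (\<Phi> [^]\<^bsub>weil_group nF F\<^esub> k \<otimes>\<^bsub>weil_group nF F\<^esub> \<tau>)
          \<otimes>\<^bsub>mat_monoid ring_of_type_algebra\<^esub> exp_nilpotent (scale_matrix (- t \<tau>) N))"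

definition weil_deligne_isomorphic ::
    "('g, 'm) monoid_scheme \<Rightarrow> ('g \<Rightarrow> 'b::field ^ 'n ^ 'n) \<Rightarrow> 'b ^ 'n ^ 'n \<Rightarrow>
     ('g \<Rightarrow> 'b ^ 'n ^ 'n) \<Rightarrow> 'b ^ 'n ^ 'n \<Rightarrow> bool" where
  "weil_deligne_isomorphic G r N r' N' \<longleftrightarrow>
     (\<exists>P\<in>carrier (GL ring_of_type_algebra).
        (\<forall>g\<in>carrier G. P \<otimes>\<^bsub>mat_monoid ring_of_type_algebra\<^esub> r g =
                        r' g \<otimes>\<^bsub>mat_monoid ring_of_type_algebra\<^esub> P) \<and>
        P \<otimes>\<^bsub>mat_monoid ring_of_type_algebra\<^esub> N = N' \<otimes>\<^bsub>mat_monoid ring_of_type_algebra\<^esub> P)"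

definition mat2 :: "'b::zero \<Rightarrow> 'b \<Rightarrow> 'b \<Rightarrow> 'b \<Rightarrow> 'b ^ 2 ^ 2" where
  "mat2 a b c d = vector [vector [a, b], vector [c, d]]"

definition special_with_character ::
    "('a::field \<Rightarrow> real) \<Rightarrow> 'a set \<Rightarrow> ('b::field_char_0 \<Rightarrow> real) \<Rightarrow> ('a \<Rightarrow> 'a) \<Rightarrow>
     (('a \<Rightarrow> 'a) \<Rightarrow> 'b) \<Rightarrow> (('a \<Rightarrow> 'a) \<Rightarrow> 'b) \<Rightarrow>
     (('a \<Rightarrow> 'a) \<Rightarrow> 'b ^ 2 ^ 2) \<Rightarrow> (('a \<Rightarrow> 'a) \<Rightarrow> 'b) \<Rightarrow> bool" where
  "special_with_character nF F nK \<Phi> \<omega> t \<rho> chi \<longleftrightarrow>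
     continuous_rep nF F nK \<rho> \<and> continuous_character nF F nK chi \<and>
     (\<exists>r N. is_weil_deligne_rep nF F \<Phi> t \<rho> r N \<and>
        weil_deligne_isomorphic (weil_group nF F) r N
          (\<lambda>g. mat2 (chi g * \<omega> g) 0 0 (chi g)) (mat2 0 1 0 0))"

definition special ::
    "('a::field \<Rightarrow> real) \<Rightarrow> 'a set \<Rightarrow> ('b::field_char_0 \<Rightarrow> real) \<Rightarrow> ('a \<Rightarrow> 'a) \<Rightarrow>
     (('a \<Rightarrow> 'a) \<Rightarrow> 'b) \<Rightarrow> (('a \<Rightarrow> 'a) \<Rightarrow> 'b) \<Rightarrow>
     (('a \<Rightarrow> 'a) \<Rightarrow> 'b ^ 2 ^ 2) \<Rightarrow> bool" where
  "special nF F nK \<Phi> \<omega> t \<rho> \<longleftrightarrow> (\<exists>chi. special_with_character nF F nK \<Phi> \<omega> t \<rho> chi)"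

end

theory Submission
  imports Defs
begin

text \<open>
  Put \<open>\<alpha>\<^sub>j = a\<^sub>j / d\<^sub>j\<close>, \<open>\<beta>\<^sub>j = b\<^sub>j / d\<^sub>j\<close> and \<open>\<gamma> = \<alpha>\<^sub>2 \<beta>\<^sub>1 / \<alpha>\<^sub>1 - \<beta>\<^sub>2\<close>, the element whose valuation occurs in
  the theorem. An intertwining matrix \<open>P\<close> of the two reductions is tested on an inertia element \<open>\<tau>\<close>
  with \<open>t \<tau> = 1\<close>: as \<open>\<alpha>\<^sub>1\<close> is a unit, \<open>P\<close> is upper triangular with diagonal \<open>(x, w)\<close> such that
  \<open>x \<alpha>\<^sub>1 \<equiv> w \<alpha>\<^sub>2\<close>, and then the lower right entries give \<open>\<chi> \<equiv> \<theta>\<close>. With \<open>h = 1 - \<omega> \<Phi>\<close>, which has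
  valuation \<open>i\<close>, the upper right entry at \<open>\<Phi>\<close> becomes \<open>(x \<alpha>\<^sub>1 \<gamma> + \<alpha>\<^sub>2 y) h \<equiv> 0\<close>, where \<open>y\<close> is the free
  upper right entry of \<open>P\<close>. This can be solved with integral \<open>y\<close> if and only if \<open>\<gamma>\<close> is integral or
  \<open>\<gamma> h\<close> is in the maximal ideal, and a solution works for all of \<open>W\<^sub>F\<close> since every
  \<open>1 - \<omega> g\<close> is a multiple of \<open>h\<close>.
\<close>

unbundle no Formal_Power_Series.fps_syntax

lemma ring_of_type_algebra_simps [simp]:
  "carrier ring_of_type_algebra = UNIV"
  "x \<otimes>\<^bsub>ring_of_type_algebra\<^esub> y = x * y"
  "\<one>\<^bsub>ring_of_type_algebra\<^esub> = 1"
  "\<zero>\<^bsub>ring_of_type_algebra\<^esub> = 0"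
  "x \<oplus>\<^bsub>ring_of_type_algebra\<^esub> y = x + y"
  by (simp_all add: ring_of_type_algebra_def)

section \<open>Two by two matrices over a ring\<close>

lemma mat_monoid_carrier_iff: "A \<in> carrier (mat_monoid R) \<longleftrightarrow> (\<forall>i j. A $ i $ j \<in> carrier R)"
  by (simp add: mat_monoid_def)

text \<open>The carrier hypotheses are what allows \<open>\<Oplus>\<close> to be expanded into its
  two summands.\<close>

lemma mat_monoid_mult_nth:
  fixes A B :: "'a ^ 2 ^ 2"
  assumes "ring R" "A \<in> carrier (mat_monoid R)" "B \<in> carrier (mat_monoid R)"
  shows "(A \<otimes>\<^bsub>mat_monoid R\<^esub> B) $ i $ j = A $ i $ 1 \<otimes>\<^bsub>R\<^esub> B $ 1 $ j \<oplus>\<^bsub>R\<^esub> A $ i $ 2 \<otimes>\<^bsub>R\<^esub> B $ 2 $ j"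
proof -
  interpret ring R by fact
  have "A $ i $ k \<in> carrier R" "B $ k $ j \<in> carrier R" for k
    using assms(2,3) by (auto simp: mat_monoid_carrier_iff)
  thus ?thesis
    by (simp add: mat_monoid_def UNIV_2)
qed

lemma mat_monoid_one_nth: "\<one>\<^bsub>mat_monoid R\<^esub> $ i $ j = (if i = j then \<one>\<^bsub>R\<^esub> else \<zero>\<^bsub>R\<^esub>)"
  by (simp add: mat_monoid_def)

lemma GL_carrierD: "P \<in> carrier (GL R) \<Longrightarrow> P $ i $ j \<in> carrier R"
  by (auto simp: GL_def units_of_def Units_def mat_monoid_carrier_iff)

text \<open>For an inverse \<open>S\<close>, the vanishing lower left entry turns the (1,1) entry of
  \<open>S P\<close> and the (2,2) entry of \<open>P S\<close> into single products, and
  commutativity makes the one-sided inverses two-sided. This serves \<open>K\<close>, its integers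
  and the residue ring alike.\<close>

lemma GL_upper_triangular_diagonal:
  fixes R (structure) and P :: "'a ^ 2 ^ 2"
  assumes "cring R" "P \<in> carrier (GL R)" "P $ 2 $ 1 = \<zero>\<^bsub>R\<^esub>"
  shows "P $ 1 $ 1 \<in> Units R" "P $ 2 $ 2 \<in> Units R"
proof -
  interpret cring R by fact
  obtain S where S: "S \<in> carrier (mat_monoid R)" "P \<in> carrier (mat_monoid R)"
    "S \<otimes>\<^bsub>mat_monoid R\<^esub> P = \<one>\<^bsub>mat_monoid R\<^esub>" "P \<otimes>\<^bsub>mat_monoid R\<^esub> S = \<one>\<^bsub>mat_monoid R\<^esub>"
    using assms(2) by (auto simp: GL_def units_of_def Units_def)
  have SP: "S $ i $ j \<in> carrier R" "P $ i $ j \<in> carrier R" for i j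
    using S by (auto simp: mat_monoid_carrier_iff)
  have "S $ 1 $ 1 \<otimes> P $ 1 $ 1 = \<one>"
    using mat_monoid_mult_nth[OF ring_axioms S(1,2), of 1 1] SP assms(3)
    by (simp add: S(3) mat_monoid_one_nth)
  thus "P $ 1 $ 1 \<in> Units R"
    using SP m_comm[of "P $ 1 $ 1" "S $ 1 $ 1"] unfolding Units_def by fastforce
  have "P $ 2 $ 2 \<otimes> S $ 2 $ 2 = \<one>"
    using mat_monoid_mult_nth[OF ring_axioms S(2,1), of 2 2] SP assms(3)
    by (simp add: S(4) mat_monoid_one_nth)
  thus "P $ 2 $ 2 \<in> Units R"
    using SP m_comm[of "P $ 2 $ 2" "S $ 2 $ 2"] unfolding Units_def by fastforce
qed

lemma GL_upper_triangularI:
  fixes R (structure) and P :: "'a ^ 2 ^ 2"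
  assumes "cring R" "P $ 1 $ 1 \<in> Units R" "P $ 2 $ 2 \<in> Units R" "P $ 1 $ 2 \<in> carrier R"
    "P $ 2 $ 1 = \<zero>\<^bsub>R\<^esub>"
  shows "P \<in> carrier (GL R)"
proof -
  interpret cring R by fact
  define x y w where "x = P $ 1 $ 1" and "y = P $ 1 $ 2" and "w = P $ 2 $ 2"
  \<comment> \<open>The usual inverse of an upper triangular matrix with diagonal
    \<open>(x, w)\<close> and corner \<open>y\<close>; only the corner of each product takes a
    computation.\<close>
  define S :: "'a ^ 2 ^ 2" where
    "S = (\<chi> i j. if i = 1 then if j = 1 then inv x else \<ominus> (inv x \<otimes> y \<otimes> inv w)
                 else if j = 1 then \<zero> else inv w)"
  have xw: "x \<in> Units R" "w \<in> Units R" "y \<in> carrier R"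
    using assms by (auto simp: x_def y_def w_def)
  hence car: "x \<in> carrier R" "w \<in> carrier R" "inv x \<in> carrier R" "inv w \<in> carrier R"
    by auto
  have S: "S $ 1 $ 1 = inv x" "S $ 1 $ 2 = \<ominus> (inv x \<otimes> y \<otimes> inv w)" "S $ 2 $ 1 = \<zero>" "S $ 2 $ 2 = inv w"
    by (simp_all add: S_def)
  have SP: "S \<in> carrier (mat_monoid R)" "P \<in> carrier (mat_monoid R)"
    using xw car assms(5) by (simp_all add: mat_monoid_carrier_iff forall_2 S flip: x_def y_def w_def)
  have units: "inv x \<otimes> x = \<one>" "x \<otimes> inv x = \<one>" "inv w \<otimes> w = \<one>" "w \<otimes> inv w = \<one>"
    using xw by simp_all
  have "inv x \<otimes> y \<oplus> \<ominus> (inv x \<otimes> y \<otimes> inv w) \<otimes> w = inv x \<otimes> y \<oplus> \<ominus> (inv x \<otimes> y \<otimes> (inv w \<otimes> w))"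
    using xw car by algebra
  also have "\<dots> = \<zero>"
    using xw car units by (simp add: r_neg)
  finally have "S \<otimes>\<^bsub>mat_monoid R\<^esub> P = \<one>\<^bsub>mat_monoid R\<^esub>"
    using xw car units assms(5)
    by (simp add: vec_eq_iff forall_2 mat_monoid_mult_nth[OF ring_axioms] SP mat_monoid_one_nth S
        flip: x_def y_def w_def)
  moreover have "x \<otimes> \<ominus> (inv x \<otimes> y \<otimes> inv w) \<oplus> y \<otimes> inv w =
      \<ominus> ((x \<otimes> inv x) \<otimes> y \<otimes> inv w) \<oplus> y \<otimes> inv w"
    using xw car by algebra
  hence "x \<otimes> \<ominus> (inv x \<otimes> y \<otimes> inv w) \<oplus> y \<otimes> inv w = \<zero>"
    using xw car units by (simp add: l_neg)
  hence "P \<otimes>\<^bsub>mat_monoid R\<^esub> S = \<one>\<^bsub>mat_monoid R\<^esub>"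
    using xw car units assms(5)
    by (simp add: vec_eq_iff forall_2 mat_monoid_mult_nth[OF ring_axioms] SP mat_monoid_one_nth S
        flip: x_def y_def w_def)
  ultimately show ?thesis
    using SP by (auto simp: GL_def units_of_def Units_def)
qed

lemma mat2_nth [simp]:
  "mat2 a b c d $ 1 $ 1 = a" "mat2 a b c d $ 1 $ 2 = b"
  "mat2 a b c d $ 2 $ 1 = c" "mat2 a b c d $ 2 $ 2 = d"
  by (simp_all add: mat2_def vector_2)

section \<open>Nonarchimedean absolute values\<close>

locale nonarchimedean_field =
  fixes nrm :: "'a::field \<Rightarrow> real"
  assumes nonneg: "nrm x \<ge> 0"
    and eq_0_iff: "nrm x = 0 \<longleftrightarrow> x = 0"
    and mult: "nrm (x * y) = nrm x * nrm y"
    and add_le_max: "nrm (x + y) \<le> max (nrm x) (nrm y)"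
begin

lemma nrm_0 [simp]: "nrm 0 = 0"
  by (simp add: eq_0_iff)

lemma nrm_1 [simp]: "nrm 1 = 1"
  using mult[of 1 1] eq_0_iff[of 1] by simp

lemma nrm_minus [simp]: "nrm (- x) = nrm x"
proof -
  have "nrm (- 1) ^ 2 = 1"
    using mult[of "- 1" "- 1"] by (simp add: power2_eq_square)
  hence "nrm (- 1) = 1"
    using nonneg[of "- 1"] by (simp add: power2_eq_1_iff)
  thus ?thesis
    using mult[of "- 1" x] by simp
qed

lemma nrm_power: "nrm (x ^ n) = nrm x ^ n"
  by (induction n) (simp_all add: mult)

lemma nrm_inverse: "nrm (inverse x) = inverse (nrm x)"
proof (cases "x = 0")
  case False
  thus ?thesis
    using mult[of x "inverse x"] by (simp add: field_simps eq_0_iff)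
qed simp

lemma nrm_divide: "nrm (x / y) = nrm x / nrm y"
  by (simp add: divide_inverse mult nrm_inverse)

lemma add_le: "nrm x \<le> r \<Longrightarrow> nrm y \<le> r \<Longrightarrow> nrm (x + y) \<le> r"
  using add_le_max[of x y] by linarith

lemma add_less: "nrm x < r \<Longrightarrow> nrm y < r \<Longrightarrow> nrm (x + y) < r"
  using add_le_max[of x y] by linarith

lemma diff_le: "nrm x \<le> r \<Longrightarrow> nrm y \<le> r \<Longrightarrow> nrm (x - y) \<le> r"
  using add_le[of x r "- y"] by simp

lemma diff_less: "nrm x < r \<Longrightarrow> nrm y < r \<Longrightarrow> nrm (x - y) < r"
  using add_less[of x r "- y"] by simp

lemma diff_commute: "nrm (x - y) = nrm (y - x)"
  using nrm_minus[of "x - y"] by simp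

lemma mult_le_1: "nrm x \<le> 1 \<Longrightarrow> nrm y \<le> 1 \<Longrightarrow> nrm (x * y) \<le> 1"
  using nonneg by (simp add: mult mult_le_one)

lemma mult_less_1: "nrm x < 1 \<Longrightarrow> nrm y \<le> 1 \<Longrightarrow> nrm (x * y) < 1"
  using mult_left_le[of "nrm y" "nrm x"] nonneg[of x] by (simp add: mult)

lemma mult_less_1': "nrm x \<le> 1 \<Longrightarrow> nrm y < 1 \<Longrightarrow> nrm (x * y) < 1"
  using mult_less_1[of y x] by (simp add: mult.commute)

lemma cong_trans: "nrm (x - y) < 1 \<Longrightarrow> nrm (y - z) < 1 \<Longrightarrow> nrm (x - z) < 1"
  using add_less[of "x - y" 1 "y - z"] by simp

text \<open>The telescoping identity of the induction step combined with the ultrametric inequality;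
  it lets congruences be raised to powers.\<close>

lemma power_diff_le:
  assumes "nrm x \<le> 1" "nrm y \<le> 1"
  shows "nrm (x ^ n - y ^ n) \<le> nrm (x - y)"
proof (induction n)
  case (Suc n)
  have "x ^ Suc n - y ^ Suc n = x * (x ^ n - y ^ n) + (x - y) * y ^ n"
    by (simp add: algebra_simps)
  moreover have "nrm (x * (x ^ n - y ^ n)) \<le> nrm (x - y)"
    using Suc mult_mono[OF assms(1) Suc] nonneg by (simp add: mult)
  moreover have "nrm ((x - y) * y ^ n) \<le> nrm (x - y)"
    using nonneg assms(2) by (simp add: mult nrm_power mult_left_le power_le_one)
  ultimately show ?case
    by (simp only: add_le)
qed (simp add: nonneg)

text \<open>Negative exponents reduce to positive ones by factoring out the unit
  \<open>u powi k\<close>. With \<open>u = \<omega> \<Phi>\<close> this bounds every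
  \<open>1 - \<omega> g\<close> by \<open>h\<close>.\<close>

lemma one_minus_powi_le:
  assumes "nrm u = 1"
  shows "nrm (1 - u powi k) \<le> nrm (1 - u)"
proof -
  have nat: "nrm (1 - u ^ n) \<le> nrm (1 - u)" for n
    using power_diff_le[of 1 u n] assms by simp
  show ?thesis
  proof (cases "k \<ge> 0")
    case True
    thus ?thesis using nat[of "nat k"] by (simp add: power_int_def)
  next
    case False
    have "u \<noteq> 0" using assms by auto
    hence "1 - u powi k = - (u powi k * (1 - u ^ nat (- k)))"
      using False by (simp add: power_int_def field_simps)
    hence "nrm (1 - u powi k) = nrm (1 - u ^ nat (- k))"
      using False assms
      by (simp only: nrm_minus mult) (simp add: power_int_def nrm_power nrm_inverse)
    thus ?thesis using nat[of "nat (- k)"] by simp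
  qed
qed

lemma Metric_space_nrm: "Metric_space UNIV (\<lambda>x y. nrm (x - y))"
proof
  show "nrm (x - z) \<le> nrm (x - y) + nrm (y - z)" for x y z
    using add_le_max[of "x - y" "y - z"] nonneg[of "x - y"] nonneg[of "y - z"] by simp
qed (auto simp: nonneg diff_commute eq_0_iff)

end

lemma padic_closure_nonarchimedean: "padic_closure p nrm \<Longrightarrow> nonarchimedean_field nrm"
  by (simp add: padic_closure_def nonarchimedean_field_def)

text \<open>It places 1 among the l-adic integers, so that surjectivity of \<open>t\<close> gives an
  inertia element with value 1.\<close>

lemma range_of_rat_subset_rat_closure:
  assumes "nonarchimedean_field nrm"
  shows "range of_rat \<subseteq> rat_closure nrm"
  using Metric_space.topspace_mtopology[OF nonarchimedean_field.Metric_space_nrm[OF assms]]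
  by (simp add: rat_closure_def abs_topology_def closure_of_subset)

section \<open>Integers and residue ring of a valued subfield\<close>

locale valued_subfield = nonarchimedean_field nrm for nrm :: "'a::field \<Rightarrow> real" +
  fixes L :: "'a set"
  assumes subfield: "subfield L ring_of_type_algebra"
begin

lemma L_closed:
  shows "0 \<in> L" "1 \<in> L" "x \<in> L \<Longrightarrow> y \<in> L \<Longrightarrow> x + y \<in> L" "x \<in> L \<Longrightarrow> y \<in> L \<Longrightarrow> x * y \<in> L"
    "x \<in> L \<Longrightarrow> - x \<in> L" "x \<in> L \<Longrightarrow> y \<in> L \<Longrightarrow> x - y \<in> L" "x \<in> L \<Longrightarrow> inverse x \<in> L"
    "x \<in> L \<Longrightarrow> y \<in> L \<Longrightarrow> x / y \<in> L"
proof -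
  interpret T: cring "ring_of_type_algebra :: 'a ring"
    by (rule cring_from_type_algebra)
  note sub = subringE[OF subfieldE(1)[OF subfield]]
  show c: "0 \<in> L" "1 \<in> L" "x \<in> L \<Longrightarrow> y \<in> L \<Longrightarrow> x + y \<in> L" "x \<in> L \<Longrightarrow> y \<in> L \<Longrightarrow> x * y \<in> L" for x y
    using sub(2,3,6,7) by auto
  show m: "- x \<in> L" if "x \<in> L" for x
  proof -
    \<comment> \<open>The subring rules speak of the negation of the ring record; uniqueness of
      additive inverses identifies it with \<open>-\<close>.\<close>
    have "\<ominus>\<^bsub>ring_of_type_algebra\<^esub> x = - x"
      by (rule T.minus_equality) auto
    thus ?thesis using sub(5)[OF that] by simp
  qed
  show "x - y \<in> L" if "x \<in> L" "y \<in> L" for x y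
    using c(3)[OF that(1) m[OF that(2)]] by simp
  show i: "inverse x \<in> L" if "x \<in> L" for x
  proof (cases "x = 0")
    case False
    hence "x \<in> Units (ring_of_type_algebra\<lparr>carrier := L\<rparr>)"
      using subfield.subfield_Units[OF subfield] that by auto
    then obtain y where "y \<in> L" "y * x = 1"
      by (auto simp: Units_def)
    thus ?thesis using inverse_unique[of y x] by (metis inverse_inverse_eq inverse_unique mult.commute)
  qed (use c in simp)
  show "x / y \<in> L" if "x \<in> L" "y \<in> L" for x y
    using c(4)[OF that(1) i[OF that(2)]] by (simp add: divide_inverse)
qed

lemma int_ring_simps [simp]:
  "carrier (int_ring nrm L) = {x \<in> L. nrm x \<le> 1}"
  "x \<otimes>\<^bsub>int_ring nrm L\<^esub> y = x * y"
  "\<one>\<^bsub>int_ring nrm L\<^esub> = 1"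
  "\<zero>\<^bsub>int_ring nrm L\<^esub> = 0"
  "x \<oplus>\<^bsub>int_ring nrm L\<^esub> y = x + y"
  by (simp_all add: int_ring_def)

lemma cring_int_ring: "cring (int_ring nrm L)"
proof (rule cringI)
  show "abelian_group (int_ring nrm L)"
  proof (rule abelian_groupI)
    fix x assume "x \<in> carrier (int_ring nrm L)"
    thus "\<exists>y\<in>carrier (int_ring nrm L). y \<oplus>\<^bsub>int_ring nrm L\<^esub> x = \<zero>\<^bsub>int_ring nrm L\<^esub>"
      by (intro bexI[of _ "- x"]) (auto simp: L_closed)
  qed (auto simp: L_closed add_le algebra_simps)
  show "comm_monoid (int_ring nrm L)"
    by (rule comm_monoidI) (auto simp: L_closed mult_le_1 algebra_simps)
qed (auto simp: algebra_simps)

lemma int_ring_Units_iff: "x \<in> Units (int_ring nrm L) \<longleftrightarrow> x \<in> L \<and> nrm x = 1"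
proof
  assume "x \<in> Units (int_ring nrm L)"
  then obtain y where y: "x \<in> L" "nrm x \<le> 1" "nrm y \<le> 1" "y * x = 1"
    by (auto simp: Units_def)
  hence "nrm y * nrm x = 1"
    by (metis mult nrm_1)
  hence "nrm x \<ge> 1"
    using y(3) nonneg[of x] mult_right_mono[of "nrm y" 1 "nrm x"] by simp
  thus "x \<in> L \<and> nrm x = 1" using y by simp
next
  assume x: "x \<in> L \<and> nrm x = 1"
  hence "x \<noteq> 0" by auto
  thus "x \<in> Units (int_ring nrm L)"
    using x L_closed(7)[of x] by (auto simp: Units_def nrm_inverse intro!: exI[of _ "inverse x"])
qed

section \<open>Reduction modulo the maximal ideal\<close>

lemma ideal_max_ideal: "ideal (max_ideal nrm L) (int_ring nrm L)"
proof -
  interpret R: cring "int_ring nrm L" by (rule cring_int_ring)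
  show ?thesis
  proof (rule idealI)
    show "ring (int_ring nrm L)" by (rule R.ring_axioms)
    show "subgroup (max_ideal nrm L) (add_monoid (int_ring nrm L))"
    proof (rule R.add.subgroupI)
      fix x assume x: "x \<in> max_ideal nrm L"
      hence eq: "\<ominus>\<^bsub>int_ring nrm L\<^esub> x = - x"
        by (intro R.minus_equality) (auto simp: max_ideal_def L_closed)
      show "\<ominus>\<^bsub>int_ring nrm L\<^esub> x \<in> max_ideal nrm L"
        unfolding eq using x by (simp add: max_ideal_def L_closed)
    qed (auto simp: max_ideal_def L_closed add_less intro: exI[of _ 0])
  qed (auto simp: max_ideal_def L_closed mult_less_1 mult_less_1')
qed

sublocale max_ideal: ideal "max_ideal nrm L" "int_ring nrm L"
  by (rule ideal_max_ideal)

lemma cring_residue_ring: "cring (residue_ring nrm L)"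
  unfolding residue_ring_def by (rule max_ideal.quotient_is_cring[OF cring_int_ring])

lemma reduction_hom: "reduction nrm L \<in> ring_hom (int_ring nrm L) (residue_ring nrm L)"
proof -
  have "reduction nrm L = (+>\<^bsub>int_ring nrm L\<^esub>) (max_ideal nrm L)"
    by (simp add: reduction_def fun_eq_iff)
  thus ?thesis
    using max_ideal.rcos_ring_hom by (simp add: residue_ring_def)
qed

text \<open>The dictionary by which every identity over the residue ring becomes a strict inequality
  for \<open>nrm\<close>; later congruences are all written in that form.\<close>

lemma reduction_eq_iff:
  assumes "x \<in> L" "nrm x \<le> 1" "y \<in> L" "nrm y \<le> 1"
  shows "reduction nrm L x = reduction nrm L y \<longleftrightarrow> nrm (x - y) < 1"
proof -
  have "\<ominus>\<^bsub>int_ring nrm L\<^esub> y = - y"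
    using assms by (intro max_ideal.minus_equality) (auto simp: L_closed)
  thus ?thesis
    using max_ideal.quotient_eq_iff_same_a_r_cos[OF ideal_max_ideal, of x y] assms
    by (auto simp: reduction_def max_ideal_def a_minus_def L_closed)
qed

lemma residue_ring_carrier: "carrier (residue_ring nrm L) = reduction nrm L ` {x \<in> L. nrm x \<le> 1}"
  by (auto simp: residue_ring_def FactRing_def A_RCOSETS_def' reduction_def)

lemma residue_ring_zero: "\<zero>\<^bsub>residue_ring nrm L\<^esub> = reduction nrm L 0"
  using ring_hom_zero[OF reduction_hom max_ideal.ring_axioms] cring_residue_ring
  by (simp add: cring_def)

lemma reduction_Units_iff:
  assumes "x \<in> L" "nrm x \<le> 1"
  shows "reduction nrm L x \<in> Units (residue_ring nrm L) \<longleftrightarrow> nrm x = 1"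
proof
  note hom = ring_hom_memE[OF reduction_hom]
  assume x: "nrm x = 1"
  hence ne: "x \<noteq> 0" by auto
  have i: "inverse x \<in> carrier (int_ring nrm L)" "x \<in> carrier (int_ring nrm L)"
    using assms x L_closed(7)[of x] by (simp_all add: nrm_inverse)
  have "reduction nrm L (inverse x) \<otimes>\<^bsub>residue_ring nrm L\<^esub> reduction nrm L x = \<one>\<^bsub>residue_ring nrm L\<^esub>"
    "reduction nrm L x \<otimes>\<^bsub>residue_ring nrm L\<^esub> reduction nrm L (inverse x) = \<one>\<^bsub>residue_ring nrm L\<^esub>"
    using ne hom(4) by (simp_all add: hom(2)[OF i, symmetric] hom(2)[OF i(2,1), symmetric])
  thus "reduction nrm L x \<in> Units (residue_ring nrm L)"
    unfolding Units_def using hom(1)[OF i(1)] hom(1)[OF i(2)] by blast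
next
  note hom = ring_hom_memE[OF reduction_hom]
  assume "reduction nrm L x \<in> Units (residue_ring nrm L)"
  then obtain y where y: "y \<in> L" "nrm y \<le> 1"
    "reduction nrm L y \<otimes>\<^bsub>residue_ring nrm L\<^esub> reduction nrm L x = \<one>\<^bsub>residue_ring nrm L\<^esub>"
    unfolding Units_def residue_ring_carrier by auto
  hence "reduction nrm L (y * x) = reduction nrm L 1"
    using hom(2)[of y x] hom(4) assms by simp
  hence "nrm (y * x - 1) < 1"
    using reduction_eq_iff[of "y * x" 1] y assms by (simp add: L_closed mult_le_1)
  \<comment> \<open>Otherwise \<open>1 = y * x - (y * x - 1)\<close> would have absolute value below
    1.\<close>
  hence "\<not> nrm (y * x) < 1"
    using diff_less[of "y * x" 1 "y * x - 1"] by auto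
  hence "\<not> nrm x < 1"
    using mult_less_1' y by blast
  thus "nrm x = 1" using assms by simp
qed

text \<open>Reduction is a ring homomorphism, so both matrix products may be computed on integral
  lifts. Intertwining thus becomes four explicit congruences.\<close>

lemma reduced_conjugation_iff:
  fixes A B P :: "'a ^ 2 ^ 2"
  assumes "\<And>i j. A $ i $ j \<in> L" "\<And>i j. nrm (A $ i $ j) \<le> 1"
    and "\<And>i j. B $ i $ j \<in> L" "\<And>i j. nrm (B $ i $ j) \<le> 1"
    and "\<And>i j. P $ i $ j \<in> L" "\<And>i j. nrm (P $ i $ j) \<le> 1"
  defines "red \<equiv> \<lambda>M::'a ^ 2 ^ 2. \<chi> i j. reduction nrm L (M $ i $ j)"
  shows "red P \<otimes>\<^bsub>mat_monoid (residue_ring nrm L)\<^esub> red A =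
           red B \<otimes>\<^bsub>mat_monoid (residue_ring nrm L)\<^esub> red P \<longleftrightarrow>
         (\<forall>i j. nrm ((P $ i $ 1 * A $ 1 $ j + P $ i $ 2 * A $ 2 $ j) -
                     (B $ i $ 1 * P $ 1 $ j + B $ i $ 2 * P $ 2 $ j)) < 1)"
proof -
  interpret Q: cring "residue_ring nrm L" by (rule cring_residue_ring)
  note hom = ring_hom_memE[OF reduction_hom]
  have car: "red M \<in> carrier (mat_monoid (residue_ring nrm L))"
    if "\<And>i j. M $ i $ j \<in> L" "\<And>i j. nrm (M $ i $ j) \<le> 1" for M
    using that unfolding red_def mat_monoid_carrier_iff residue_ring_carrier by simp
  have prod: "(red M \<otimes>\<^bsub>mat_monoid (residue_ring nrm L)\<^esub> red N) $ i $ j =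
      reduction nrm L (M $ i $ 1 * N $ 1 $ j + M $ i $ 2 * N $ 2 $ j)"
    if "\<And>i j. M $ i $ j \<in> L" "\<And>i j. nrm (M $ i $ j) \<le> 1"
      "\<And>i j. N $ i $ j \<in> L" "\<And>i j. nrm (N $ i $ j) \<le> 1" for M N i j
  proof -
    have "M $ i $ k * N $ k $ j \<in> carrier (int_ring nrm L)" for k
      using that by (simp add: L_closed(4) mult_le_1)
    hence "reduction nrm L (M $ i $ 1 * N $ 1 $ j + M $ i $ 2 * N $ 2 $ j) =
        reduction nrm L (M $ i $ 1 * N $ 1 $ j) \<oplus>\<^bsub>residue_ring nrm L\<^esub> reduction nrm L (M $ i $ 2 * N $ 2 $ j)"
      using hom(3)[of "M $ i $ 1 * N $ 1 $ j" "M $ i $ 2 * N $ 2 $ j"] unfolding int_ring_simps(5) by blast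
    moreover have "reduction nrm L (M $ i $ k * N $ k $ j) =
        red M $ i $ k \<otimes>\<^bsub>residue_ring nrm L\<^esub> red N $ k $ j" for k
      using hom(2)[of "M $ i $ k" "N $ k $ j"] that by (simp add: red_def)
    ultimately show ?thesis
      by (simp only: mat_monoid_mult_nth[OF Q.ring_axioms car[OF that(1,2)] car[OF that(3,4)]])
  qed
  have closed: "x * y + z * w \<in> L \<and> nrm (x * y + z * w) \<le> 1"
    if "x \<in> L" "y \<in> L" "z \<in> L" "w \<in> L" "nrm x \<le> 1" "nrm y \<le> 1" "nrm z \<le> 1" "nrm w \<le> 1" for x y z w
    using that by (simp add: L_closed(3,4) add_le mult_le_1)
  have "reduction nrm L (P $ i $ 1 * A $ 1 $ j + P $ i $ 2 * A $ 2 $ j) =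
        reduction nrm L (B $ i $ 1 * P $ 1 $ j + B $ i $ 2 * P $ 2 $ j) \<longleftrightarrow>
      nrm ((P $ i $ 1 * A $ 1 $ j + P $ i $ 2 * A $ 2 $ j) -
           (B $ i $ 1 * P $ 1 $ j + B $ i $ 2 * P $ 2 $ j)) < 1" for i j
    by (rule reduction_eq_iff) (simp_all only: closed assms(1-6))
  thus ?thesis
    by (simp only: vec_eq_iff prod[OF assms(5,6) assms(1,2)] prod[OF assms(3,4) assms(5,6)])
qed

lemma GL_int_ring_entry: "P \<in> carrier (GL (int_ring nrm L)) \<Longrightarrow> P $ i $ j \<in> L \<and> nrm (P $ i $ j) \<le> 1"
  using GL_carrierD[of P "int_ring nrm L"] by simp

section \<open>Normalized valuations\<close>

context
  fixes v :: "'a \<Rightarrow> ereal"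
  assumes v: "normalized_valuation nrm L v"
begin

lemma valuation_0: "v 0 = \<infinity>"
  and valuation_mult: "x \<in> L \<Longrightarrow> y \<in> L \<Longrightarrow> v (x * y) = v x + v y"
  and valuation_add: "x \<in> L \<Longrightarrow> y \<in> L \<Longrightarrow> v (x + y) \<ge> min (v x) (v y)"
  using v by (simp_all add: normalized_valuation_def)

lemma valuation_nonneg_iff: "x \<in> L \<Longrightarrow> v x \<ge> 0 \<longleftrightarrow> nrm x \<le> 1"
  using v by (auto simp: normalized_valuation_def)

text \<open>Cancellation fails at infinity in \<open>ereal\<close>; naming the integer value of a
  nonzero element turns the later computations into integer arithmetic.\<close>

lemma valuation_int:
  assumes "x \<in> L" "x \<noteq> 0"
  shows "\<exists>n::int. v x = ereal (of_int n)"
  using v assms unfolding normalized_valuation_def by blast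

lemma uniformizer: obtains \<pi> where "\<pi> \<in> L" "\<pi> \<noteq> 0" "v \<pi> = 1"
proof -
  have "v ` (L - {0}) = range (\<lambda>n::int. ereal (of_int n))"
    using v by (simp add: normalized_valuation_def)
  hence "ereal (of_int 1) \<in> v ` (L - {0})"
    by simp
  then obtain \<pi> where "\<pi> \<in> L - {0}" "ereal (of_int 1) = v \<pi>" ..
  thus thesis using that[of \<pi>] by (simp add: one_ereal_def)
qed

lemma valuation_1: "v 1 = 0"
proof -
  obtain n :: int where "v 1 = ereal (of_int n)"
    using valuation_int[of 1] L_closed(2) by auto
  thus ?thesis
    using valuation_mult[of 1 1] L_closed(2) by (simp add: zero_ereal_def)
qed

lemma valuation_inverse:
  assumes "x \<in> L" "x \<noteq> 0"
  shows "v (inverse x) = - v x"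
proof -
  obtain m n :: int where "v x = ereal (of_int m)" "v (inverse x) = ereal (of_int n)"
    using valuation_int[of x] valuation_int[of "inverse x"] assms L_closed(7)[of x] by auto
  moreover have "v x + v (inverse x) = 0"
    using valuation_mult[of x "inverse x"] assms L_closed(7)[of x] valuation_1 by simp
  ultimately show ?thesis
    by (simp add: zero_ereal_def)
qed

text \<open>The only link between \<open>v\<close> and \<open>nrm\<close> is the ring of integers,
  so \<open>nrm x < 1\<close> is read as non-integrality of \<open>inverse x\<close>; as values are
  integers, positive means at least 1.\<close>

lemma valuation_ge_1_iff:
  assumes "x \<in> L"
  shows "v x \<ge> 1 \<longleftrightarrow> nrm x < 1"
proof (cases "x = 0")
  case False
  obtain n :: int where n: "v x = ereal (of_int n)"
    using valuation_int assms False by blast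
  have "nrm x > 0"
    using False nonneg[of x] eq_0_iff[of x] by linarith
  hence "nrm x < 1 \<longleftrightarrow> \<not> nrm (inverse x) \<le> 1"
    by (simp add: nrm_inverse one_less_inverse_iff not_le)
  also have "\<dots> \<longleftrightarrow> \<not> v (inverse x) \<ge> 0"
    using valuation_nonneg_iff[of "inverse x"] assms L_closed(7)[of x] by simp
  also have "\<dots> \<longleftrightarrow> 1 \<le> n"
    using valuation_inverse[OF assms False] n by auto
  also have "\<dots> \<longleftrightarrow> v x \<ge> 1"
    by (simp add: n one_ereal_def)
  finally show ?thesis ..
qed (simp add: valuation_0)

lemma valuation_eq_0:
  assumes "x \<in> L" "nrm x = 1"
  shows "v x = 0"
proof -
  obtain n :: int where n: "v x = ereal (of_int n)"
    using valuation_int[of x] assms by force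
  moreover have "v x \<ge> 0" "\<not> v x \<ge> 1"
    using valuation_nonneg_iff valuation_ge_1_iff assms by auto
  ultimately show ?thesis
    by (simp add: one_ereal_def zero_ereal_def)
qed

text \<open>Induction on \<open>n\<close>, starting from the whole ring of integers. Products and
  sums respect the lower bound on \<open>v\<close>; conversely a uniformizer splits off as
  \<open>x = (x / \<pi>) * \<pi>\<close>.\<close>

lemma max_ideal_power_iff: "x \<in> max_ideal_power nrm L n \<longleftrightarrow> x \<in> L \<and> v x \<ge> ereal (of_nat n)"
proof (induction n arbitrary: x)
  case 0
  thus ?case
    using valuation_nonneg_iff by (auto simp: max_ideal_power_def ideals_set_def zero_ereal_def)
next
  case (Suc n)
  have prod: "max_ideal_power nrm L (Suc n) =
      ideal_prod (int_ring nrm L) (max_ideal_power nrm L n) (max_ideal nrm L)"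
    by (simp add: max_ideal_power_def ideals_set_def)
  show ?case
  proof
    assume "x \<in> max_ideal_power nrm L (Suc n)"
    thus "x \<in> L \<and> v x \<ge> ereal (of_nat (Suc n))"
      unfolding prod
    proof (induction rule: ideal_prod.induct)
      case (prod i j)
      hence "i \<in> L" "v i \<ge> ereal (of_nat n)" "j \<in> L" "v j \<ge> 1"
        using Suc valuation_ge_1_iff by (auto simp: max_ideal_def)
      thus ?case
        using add_mono[of "ereal (of_nat n)" "v i" 1 "v j"]
        by (simp add: valuation_mult L_closed one_ereal_def add.commute)
    next
      case (sum x y)
      thus ?case
        using valuation_add[of x y] by (auto simp: L_closed min_def split: if_splits)
    qed
  next
    assume x: "x \<in> L \<and> v x \<ge> ereal (of_nat (Suc n))"
    obtain \<pi> where \<pi>: "\<pi> \<in> L" "\<pi> \<noteq> 0" "v \<pi> = 1"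
      by (rule uniformizer)
    have "v (x / \<pi>) \<ge> ereal (of_nat n)"
    proof (cases "x = 0")
      case False
      then obtain m k :: int where "v x = ereal (of_int m)" "v (x / \<pi>) = ereal (of_int k)"
        using valuation_int[of x] valuation_int[of "x / \<pi>"] x \<pi> L_closed(8)[of x \<pi>] by auto
      moreover have "v (x / \<pi> * \<pi>) = v (x / \<pi>) + 1"
        using valuation_mult[of "x / \<pi>" \<pi>] x \<pi> L_closed(8)[of x \<pi>] by simp
      ultimately show ?thesis
        using x \<pi> by (simp add: one_ereal_def)
    qed (simp add: valuation_0)
    hence "x / \<pi> \<in> max_ideal_power nrm L n"
      using Suc x \<pi> L_closed(8)[of x \<pi>] by simp
    moreover have "\<pi> \<in> max_ideal nrm L"
      using valuation_ge_1_iff[of \<pi>] \<pi> by (simp add: max_ideal_def)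
    ultimately have "x / \<pi> * \<pi> \<in> max_ideal_power nrm L (Suc n)"
      unfolding prod using ideal_prod.prod[of "x / \<pi>" _ \<pi> _ "int_ring nrm L"] by simp
    thus "x \<in> max_ideal_power nrm L (Suc n)"
      using \<pi> by simp
  qed
qed

lemma valuation_eqI:
  assumes "x \<in> max_ideal_power nrm L n" "\<And>m. x \<in> max_ideal_power nrm L m \<Longrightarrow> m \<le> n"
  shows "v x = ereal (of_nat n)"
proof -
  have x: "x \<in> L" "v x \<ge> ereal (of_nat n)"
    using assms(1) by (auto simp: max_ideal_power_iff)
  \<comment> \<open>Zero lies in every power of the maximal ideal, against the maximality of
    \<open>n\<close>.\<close>
  have "x \<noteq> 0"
    using assms(2)[of "Suc n"] x by (auto simp: max_ideal_power_iff valuation_0)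
  then obtain k :: int where k: "v x = ereal (of_int k)"
    using valuation_int x by blast
  have "nat k \<le> n"
    using assms(2)[of "nat k"] x k by (cases "k \<ge> 0") (auto simp: max_ideal_power_iff)
  thus ?thesis
    using x(2) k by simp
qed

text \<open>An integer \<open>m\<close> is at least \<open>min 0 (1 - n)\<close> exactly when
  \<open>m \<ge> 0\<close> or \<open>m + n \<ge> 1\<close>; for \<open>m = v x\<close> these are
  integrality of \<open>x\<close> and smallness of \<open>x * h\<close>.\<close>

lemma valuation_ge_min_iff:
  assumes "x \<in> L" "h \<in> L" "v h = ereal (of_nat n)"
  shows "v x \<ge> ereal (of_int (min 0 (1 - int n))) \<longleftrightarrow> nrm x \<le> 1 \<or> nrm (x * h) < 1"
proof (cases "x = 0")
  case False
  then obtain m :: int where "v x = ereal (of_int m)"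
    using valuation_int assms by blast
  moreover have "nrm x \<le> 1 \<longleftrightarrow> v x \<ge> 0" "nrm (x * h) < 1 \<longleftrightarrow> v x + v h \<ge> 1"
    using assms valuation_nonneg_iff[of x] valuation_ge_1_iff[of "x * h"] valuation_mult[of x h] L_closed(4)[of x h]
    by auto
  ultimately show ?thesis
    using assms(3) by (auto simp: zero_ereal_def one_ereal_def min_def)
qed (simp add: valuation_0)

end

end

section \<open>The Weil group\<close>

lemma galois_set_iff:
  "\<sigma> \<in> galois_set L \<longleftrightarrow> bij \<sigma> \<and> (\<forall>x y. \<sigma> (x + y) = \<sigma> x + \<sigma> y) \<and> (\<forall>x y. \<sigma> (x * y) = \<sigma> x * \<sigma> y) \<and>
     \<sigma> 1 = 1 \<and> (\<forall>x\<in>L. \<sigma> x = x)"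
  by (auto simp: galois_set_def ring_iso_def ring_hom_def)

lemma galois_set_comp: "\<sigma> \<in> galois_set L \<Longrightarrow> \<tau> \<in> galois_set L \<Longrightarrow> \<sigma> \<circ> \<tau> \<in> galois_set L"
  by (auto simp: galois_set_iff intro: bij_comp)

lemma galois_set_inv:
  assumes "\<sigma> \<in> galois_set L"
  shows "inv_into UNIV \<sigma> \<in> galois_set L"
proof -
  have \<sigma>: "bij \<sigma>" and eq: "\<And>x. \<sigma> (inv_into UNIV \<sigma> x) = x" "\<And>x. inv_into UNIV \<sigma> (\<sigma> x) = x"
    using assms by (auto simp: galois_set_iff bij_is_surj surj_f_inv_f bij_is_inj)
  have "inv_into UNIV \<sigma> x = y \<longleftrightarrow> x = \<sigma> y" for x y
    using eq by metis
  thus ?thesis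
    using assms bij_imp_bij_inv[OF \<sigma>] eq(1) by (simp add: galois_set_iff)
qed

lemma galois_set_inverse:
  assumes "\<sigma> \<in> galois_set L"
  shows "\<sigma> (inverse x) = inverse (\<sigma> x)"
proof (cases "x = 0")
  case True
  have "\<sigma> 0 + \<sigma> 0 = \<sigma> 0"
    using assms by (metis add_0 galois_set_iff)
  hence "\<sigma> 0 = 0"
    by (metis add_cancel_right_right)
  thus ?thesis using True by simp
next
  case False
  hence "\<sigma> x * \<sigma> (inverse x) = 1"
    using assms by (metis galois_set_iff right_inverse)
  thus ?thesis by (metis inverse_unique)
qed

lemma galois_set_power:
  assumes "\<sigma> \<in> galois_set L"
  shows "\<sigma> (x ^ n) = \<sigma> x ^ n"
  using assms by (induction n) (auto simp: galois_set_iff)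

lemma weil_group_simps [simp]:
  "x \<otimes>\<^bsub>weil_group nrm L\<^esub> y = x \<circ> y"
  "\<one>\<^bsub>weil_group nrm L\<^esub> = id"
  by (simp_all add: weil_group_def)

lemma weil_group_nat_pow: "\<sigma> [^]\<^bsub>weil_group nrm L\<^esub> n = \<sigma> ^^ n"
  by (induction n) (simp_all add: fun_eq_iff funpow_swap1)

lemma inertia_subset_weil_group: "inertia nrm L \<subseteq> carrier (weil_group nrm L)"
  by (auto simp: inertia_def weil_group_def)

context nonarchimedean_field
begin

lemma id_in_inertia: "id \<in> inertia nrm L"
  by (simp add: inertia_def galois_set_iff acts_as_frobenius_power_def)

context
  fixes L :: "'a set" and \<Phi> :: "'a \<Rightarrow> 'a"
  assumes frobenius: "frobenius_element nrm L \<Phi>"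
begin

text \<open>The cardinality of an infinite set is 0 by convention; with that value the congruence
  satisfied by \<open>\<Phi>\<close> at 0 would say that 1 is congruent to 0.\<close>

lemma residue_card_pos: "residue_card nrm L > 0"
proof (rule ccontr)
  assume "\<not> residue_card nrm L > 0"
  hence "residue_card nrm L = 0" by simp
  moreover have "nrm (\<Phi> 0 ^ (residue_card nrm L ^ nat 1) - 0) < 1"
    using frobenius unfolding frobenius_element_def acts_as_frobenius_power_def
    by (auto dest: spec[of _ 0])
  ultimately have "nrm (\<Phi> 0 ^ 0 - 0) < 1" by simp
  thus False by simp
qed

lemma frobenius_galois_set: "\<Phi> ^^ n \<in> galois_set L"
proof (induction n)
  case (Suc n)
  have "\<Phi> \<in> galois_set L"
    using frobenius by (simp add: frobenius_element_def weil_group_def)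
  thus ?case
    using galois_set_comp[OF _ Suc] by (simp only: funpow.simps)
qed (simp add: galois_set_iff flip: id_def)

text \<open>A positive power of \<open>y\<close> is integral, being congruent to \<open>x\<close>.
  This is how integrality is transported along \<open>\<Phi>\<close>, without first showing that
  automorphisms are isometries.\<close>

lemma frobenius_power_integral_imp:
  assumes "nrm (y ^ (residue_card nrm L ^ n) - x) < 1" "nrm x \<le> 1"
  shows "nrm y \<le> 1"
proof -
  have "nrm (y ^ (residue_card nrm L ^ n)) \<le> 1"
    using add_le[of "y ^ (residue_card nrm L ^ n) - x" 1 x] assms by simp
  thus ?thesis
    using residue_card_pos nonneg[of y] by (simp add: nrm_power power_le_one_iff)
qed

text \<open>The induction hypothesis is applied to the integral element \<open>\<Phi> x\<close>,
  raised to the power \<open>q\<close>, and followed by the congruence for \<open>\<Phi>\<close>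
  itself.\<close>

lemma frobenius_power_cong:
  assumes "nrm x \<le> 1"
  shows "nrm ((\<Phi> ^^ n) x ^ (residue_card nrm L ^ n) - x) < 1"
  using assms
proof (induction n arbitrary: x)
  case (Suc n)
  let ?q = "residue_card nrm L"
  have 1: "nrm (\<Phi> x ^ (?q ^ 1) - x) < 1"
    using frobenius Suc.prems by (simp add: frobenius_element_def acts_as_frobenius_power_def)
  hence int: "nrm (\<Phi> x) \<le> 1"
    using frobenius_power_integral_imp Suc.prems by blast
  let ?y = "(\<Phi> ^^ n) (\<Phi> x) ^ (?q ^ n)"
  have IH: "nrm (?y - \<Phi> x) < 1"
    using Suc.IH[OF int] .
  have "nrm ?y \<le> 1"
    using add_le[of "?y - \<Phi> x" 1 "\<Phi> x"] IH int by simp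
  hence "nrm (?y ^ ?q - \<Phi> x ^ ?q) < 1"
    using power_diff_le[of ?y "\<Phi> x" ?q] IH int by simp
  hence "nrm (?y ^ ?q - x) < 1"
    by (rule cong_trans) (use 1 in simp)
  thus ?case
    by (simp add: funpow_swap1 mult.commute flip: power_mult)
qed simp

text \<open>A power of the image is congruent to \<open>x\<close>, hence small, and only small
  elements have small powers.\<close>

lemma frobenius_power_small:
  assumes "nrm x < 1"
  shows "nrm ((\<Phi> ^^ n) x) < 1"
proof -
  let ?y = "(\<Phi> ^^ n) x ^ (residue_card nrm L ^ n)"
  have "nrm ?y < 1"
    using add_less[of "?y - x" 1 x] frobenius_power_cong[of x n] assms by simp
  thus ?thesis
    using one_le_power[of "nrm ((\<Phi> ^^ n) x)"] by (metis nrm_power not_le)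
qed

lemma inv_frobenius_power_cong:
  assumes "nrm x \<le> 1"
  shows "nrm (inv_into UNIV (\<Phi> ^^ n) x - x ^ (residue_card nrm L ^ n)) < 1"
proof -
  define y where "y = inv_into UNIV (\<Phi> ^^ n) x"
  have y: "(\<Phi> ^^ n) y = x"
    using frobenius_galois_set[of n] by (simp add: y_def galois_set_iff bij_is_surj surj_f_inv_f)
  \<comment> \<open>If \<open>y\<close> were not integral, \<open>inverse y\<close> would be small,
    hence also its image \<open>inverse x\<close>, contradicting integrality of
    \<open>x\<close>.\<close>
  have "nrm y \<le> 1"
  proof (rule ccontr)
    assume "\<not> nrm y \<le> 1"
    hence "nrm (inverse y) < 1"
      by (simp add: nrm_inverse inverse_less_1_iff)
    hence "nrm (inverse x) < 1"
      using frobenius_power_small[of "inverse y" n] galois_set_inverse[OF frobenius_galois_set] y by metis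
    \<comment> \<open>The case must be excluded because \<open>inverse 0 = 0\<close> is small as
      well.\<close>
    moreover have "x \<noteq> 0"
    proof -
      have "y \<noteq> 0"
        using \<open>\<not> nrm y \<le> 1\<close> by auto
      hence "(\<Phi> ^^ n) (y * inverse y) = 1"
        using frobenius_galois_set[of n] by (simp add: galois_set_iff)
      hence "x * (\<Phi> ^^ n) (inverse y) = 1"
        using frobenius_galois_set[of n] y unfolding galois_set_iff by metis
      thus ?thesis by auto
    qed
    ultimately show False
      using assms nonneg[of x] eq_0_iff[of x] by (simp add: nrm_inverse inverse_less_1_iff)
  qed
  from frobenius_power_cong[OF this, of n] show ?thesis
    unfolding y by (simp add: y_def diff_commute)
qed

text \<open>
  Only the inverses of the powers of \<open>\<Phi>\<close> are needed, and for these no injectivity of the Frobenius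
  map of the residue field is required, so it is not shown that the Weil group is a group.
\<close>

lemma weil_group_inv_frobenius_power: "inv\<^bsub>weil_group nrm L\<^esub> (\<Phi> ^^ n) = inv_into UNIV (\<Phi> ^^ n)"
proof -
  have bij: "bij (\<Phi> ^^ n)"
    using frobenius_galois_set[of n] by (simp add: galois_set_iff)
  have "acts_as_frobenius_power nrm L (int n) (inv_into UNIV (\<Phi> ^^ n))"
    using inv_frobenius_power_cong by (simp add: acts_as_frobenius_power_def)
  hence car: "inv_into UNIV (\<Phi> ^^ n) \<in> carrier (weil_group nrm L)"
    using galois_set_inv[OF frobenius_galois_set] by (auto simp: weil_group_def)
  have eq: "(\<Phi> ^^ n) \<circ> inv_into UNIV (\<Phi> ^^ n) = id" "inv_into UNIV (\<Phi> ^^ n) \<circ> (\<Phi> ^^ n) = id"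
    using bij by (simp_all add: bij_is_surj bij_is_inj flip: surj_iff)
  \<comment> \<open>The inverse in the monoid record is a definite description, so existence and
    uniqueness are checked directly.\<close>
  show ?thesis
    unfolding m_inv_def
  proof (rule the_equality)
    fix \<sigma> assume "\<sigma> \<in> carrier (weil_group nrm L) \<and> (\<Phi> ^^ n) \<otimes>\<^bsub>weil_group nrm L\<^esub> \<sigma> = \<one>\<^bsub>weil_group nrm L\<^esub> \<and>
        \<sigma> \<otimes>\<^bsub>weil_group nrm L\<^esub> (\<Phi> ^^ n) = \<one>\<^bsub>weil_group nrm L\<^esub>"
    thus "\<sigma> = inv_into UNIV (\<Phi> ^^ n)"
      using inv_unique_comp[of "\<Phi> ^^ n" \<sigma>] by simp
  qed (simp add: car eq)
qed

text \<open>If \<open>g\<close> acts as the \<open>m\<close>-th power of the arithmetic Frobenius,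
  then \<open>k = - m\<close>, since \<open>\<Phi>\<close> is geometric. The two signs of
  \<open>m\<close> differ in whether \<open>P\<close> or its inverse is composed with
  \<open>g\<close> to reach inertia.\<close>

lemma weil_group_decomposition:
  assumes "g \<in> carrier (weil_group nrm L)"
  obtains k :: int and \<tau> where "\<tau> \<in> inertia nrm L"
    "g = \<Phi> [^]\<^bsub>weil_group nrm L\<^esub> k \<otimes>\<^bsub>weil_group nrm L\<^esub> \<tau>"
proof -
  obtain m where g: "g \<in> galois_set L" and m: "acts_as_frobenius_power nrm L m g"
    using assms by (auto simp: weil_group_def)
  define n where "n = nat \<bar>m\<bar>"
  define P where "P = \<Phi> ^^ n"
  define N where "N = residue_card nrm L ^ n"
  note P = frobenius_galois_set[of n, folded P_def]
  have bij: "bij P"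
    using P by (simp add: galois_set_iff)
  show thesis
  proof (cases "m \<ge> 0")
    case True
    have "nrm ((P \<circ> g) x - x) < 1" if x: "nrm x \<le> 1" for x
    proof -
      \<comment> \<open>The error \<open>e\<close> is small and stays small under \<open>P\<close>,
        so \<open>P (g x)\<close> is congruent to \<open>P x ^ N\<close>, which is congruent to
        \<open>x\<close>.\<close>
      define e where "e = g x - x ^ N"
      have "nrm (P e) < 1"
        using m True x frobenius_power_small[of e n]
        by (simp add: acts_as_frobenius_power_def e_def N_def n_def P_def)
      moreover have "P (g x) = P x ^ N + P e"
        using P galois_set_power[OF P] unfolding e_def galois_set_iff by (metis add_diff_cancel diff_add_cancel add.commute)
      moreover have "nrm (P x ^ N - x) < 1"
        using frobenius_power_cong[OF x] by (simp add: P_def N_def)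
      ultimately show ?thesis
        using add_less[of "P x ^ N - x" 1 "P e"] by (simp add: algebra_simps)
    qed
    hence "P \<circ> g \<in> inertia nrm L"
      using galois_set_comp[OF P g] by (simp add: inertia_def acts_as_frobenius_power_def)
    \<comment> \<open>For \<open>n = 0\<close> the exponent is not negative and the integer power
      does not unfold to \<open>inv\<close>, hence the case distinction.\<close>
    moreover have "\<Phi> [^]\<^bsub>weil_group nrm L\<^esub> (- int n) = inv_into UNIV P"
    proof (cases "n = 0")
      case False
      thus ?thesis
        using weil_group_inv_frobenius_power[of n] by (simp add: int_pow_def2 weil_group_nat_pow P_def)
    qed (simp add: int_pow_def2 weil_group_nat_pow P_def)
    moreover have "g = inv_into UNIV P \<circ> (P \<circ> g)"
      using bij by (simp add: fun_eq_iff bij_is_inj)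
    ultimately show ?thesis
      using that[of "P \<circ> g" "- int n"] by simp
  next
    case False
    have "nrm ((inv_into UNIV P \<circ> g) x - x) < 1" if x: "nrm x \<le> 1" for x
    proof -
      have 1: "nrm (g x ^ N - x) < 1"
        using m False x by (simp add: acts_as_frobenius_power_def N_def n_def)
      hence "nrm (g x) \<le> 1"
        using frobenius_power_integral_imp x by (simp add: N_def)
      from inv_frobenius_power_cong[OF this, of n] have "nrm (inv_into UNIV P (g x) - g x ^ N) < 1"
        by (simp add: P_def N_def)
      from cong_trans[OF this 1] show ?thesis by simp
    qed
    hence "inv_into UNIV P \<circ> g \<in> inertia nrm L"
      using galois_set_comp[OF galois_set_inv[OF P] g]
      by (simp add: inertia_def acts_as_frobenius_power_def)
    moreover have "g = P \<circ> (inv_into UNIV P \<circ> g)"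
      using bij by (simp add: fun_eq_iff bij_is_surj surj_f_inv_f)
    ultimately show ?thesis
      using that[of "inv_into UNIV P \<circ> g" "int n"] by (simp add: int_pow_int weil_group_nat_pow P_def)
  qed
qed

end

end

section \<open>Reductions of upper triangular representations\<close>

context valued_subfield
begin

lemma reduced_matrix_lift:
  fixes Q :: "'a set ^ 2 ^ 2"
  assumes "\<And>i j. Q $ i $ j \<in> carrier (residue_ring nrm L)"
  obtains P :: "'a ^ 2 ^ 2" where "\<And>i j. P $ i $ j \<in> L" "\<And>i j. nrm (P $ i $ j) \<le> 1"
    "Q = (\<chi> i j. reduction nrm L (P $ i $ j))"
proof -
  have "\<exists>x. x \<in> L \<and> nrm x \<le> 1 \<and> Q $ i $ j = reduction nrm L x" for i j
    using assms[of i j] by (auto simp: residue_ring_carrier)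
  then obtain f where f: "\<And>i j. f i j \<in> L \<and> nrm (f i j) \<le> 1 \<and> Q $ i $ j = reduction nrm L (f i j)"
    by metis
  show thesis
    by (rule that[of "\<chi> i j. f i j"]) (simp_all add: f vec_eq_iff)
qed

text \<open>
  The parameter \<open>s\<close> of \<open>M\<close> is the value of \<open>t\<close> on the inertial part of a group element, \<open>u\<close> is an
  inertia element with \<open>t u = 1\<close>, and \<open>f\<close> is the Frobenius element.
\<close>

context
  fixes G :: "('g, 'm) monoid_scheme" and \<rho>1 \<rho>2 :: "'g \<Rightarrow> 'a ^ 2 ^ 2"
    and \<eta> \<theta> \<omega> :: "'g \<Rightarrow> 'a" and \<alpha>1 \<beta>1 \<alpha>2 \<beta>2 :: 'a and u f :: 'g
    and M :: "'a \<Rightarrow> 'a \<Rightarrow> 'a \<Rightarrow> 'a \<Rightarrow> 'a \<Rightarrow> 'a ^ 2 ^ 2" and h \<gamma> :: 'a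
  defines "M \<equiv> \<lambda>\<alpha> \<beta> s c w. mat2 (c * w) (\<alpha> * s * (c * w) + \<beta> * (c - c * w)) 0 c"
    and "h \<equiv> 1 - \<omega> f" and "\<gamma> \<equiv> \<alpha>2 * \<beta>1 / \<alpha>1 - \<beta>2"
  assumes GL: "\<And>g. g \<in> carrier G \<Longrightarrow> \<rho>1 g \<in> carrier (GL (int_ring nrm L))"
      "\<And>g. g \<in> carrier G \<Longrightarrow> \<rho>2 g \<in> carrier (GL (int_ring nrm L))"
    and shape: "\<And>g. g \<in> carrier G \<Longrightarrow> \<exists>s. nrm s \<le> 1 \<and>
      \<rho>1 g = M \<alpha>1 \<beta>1 s (\<eta> g) (\<omega> g) \<and> \<rho>2 g = M \<alpha>2 \<beta>2 s (\<theta> g) (\<omega> g)"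
    and u: "u \<in> carrier G" "\<rho>1 u = M \<alpha>1 \<beta>1 1 (\<eta> u) 1" "\<rho>2 u = M \<alpha>2 \<beta>2 1 (\<theta> u) 1"
    and f: "f \<in> carrier G" "\<rho>1 f = M \<alpha>1 \<beta>1 0 (\<eta> f) (\<omega> f)" "\<rho>2 f = M \<alpha>2 \<beta>2 0 (\<theta> f) (\<omega> f)"
    and \<omega>_le: "\<And>g. g \<in> carrier G \<Longrightarrow> nrm (1 - \<omega> g) \<le> nrm h"
    and in_L: "\<alpha>1 \<in> L" "\<alpha>2 \<in> L" "\<beta>1 \<in> L" "\<beta>2 \<in> L"
    and unit: "nrm \<alpha>1 = 1" "nrm \<alpha>2 = 1"
begin

section \<open>Consequences of integrality of the representations\<close>

lemma entries:
  "g \<in> carrier G \<Longrightarrow> \<rho>1 g $ i $ j \<in> L" "g \<in> carrier G \<Longrightarrow> nrm (\<rho>1 g $ i $ j) \<le> 1"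
  "g \<in> carrier G \<Longrightarrow> \<rho>2 g $ i $ j \<in> L" "g \<in> carrier G \<Longrightarrow> nrm (\<rho>2 g $ i $ j) \<le> 1"
  using GL_int_ring_entry GL by blast+

lemma M_nth:
  "M \<alpha> \<beta> s c w $ 1 $ 1 = c * w" "M \<alpha> \<beta> s c w $ 1 $ 2 = \<alpha> * s * (c * w) + \<beta> * (c - c * w)"
  "M \<alpha> \<beta> s c w $ 2 $ 1 = 0" "M \<alpha> \<beta> s c w $ 2 $ 2 = c"
  by (simp_all add: M_def)

lemma shape_nth:
  assumes "g \<in> carrier G"
  obtains s where "nrm s \<le> 1"
    "\<rho>1 g $ 1 $ 1 = \<eta> g * \<omega> g" "\<rho>1 g $ 2 $ 1 = 0" "\<rho>1 g $ 2 $ 2 = \<eta> g"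
    "\<rho>1 g $ 1 $ 2 = \<alpha>1 * s * (\<eta> g * \<omega> g) + \<beta>1 * (\<eta> g - \<eta> g * \<omega> g)"
    "\<rho>2 g $ 1 $ 1 = \<theta> g * \<omega> g" "\<rho>2 g $ 2 $ 1 = 0" "\<rho>2 g $ 2 $ 2 = \<theta> g"
    "\<rho>2 g $ 1 $ 2 = \<alpha>2 * s * (\<theta> g * \<omega> g) + \<beta>2 * (\<theta> g - \<theta> g * \<omega> g)"
proof -
  obtain s where "nrm s \<le> 1" "\<rho>1 g = M \<alpha>1 \<beta>1 s (\<eta> g) (\<omega> g)" "\<rho>2 g = M \<alpha>2 \<beta>2 s (\<theta> g) (\<omega> g)"
    using shape[OF assms] by blast
  thus thesis
    by (intro that[of s]) (simp_all add: M_nth)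
qed

text \<open>An upper triangular matrix that is invertible over the integers has units on its
  diagonal, here \<open>\<eta> g * \<omega> g\<close> and \<open>\<eta> g\<close>, and likewise for
  \<open>\<theta>\<close>.\<close>

lemma character_units:
  assumes "g \<in> carrier G"
  shows "nrm (\<eta> g) = 1" "nrm (\<theta> g) = 1" "nrm (\<omega> g) = 1"
proof -
  obtain s where s: "\<rho>1 g $ 1 $ 1 = \<eta> g * \<omega> g" "\<rho>1 g $ 2 $ 1 = 0" "\<rho>1 g $ 2 $ 2 = \<eta> g"
    "\<rho>2 g $ 2 $ 1 = 0" "\<rho>2 g $ 2 $ 2 = \<theta> g"
    by (rule shape_nth[OF assms])
  show 1: "nrm (\<eta> g) = 1" "nrm (\<theta> g) = 1"
    using GL_upper_triangular_diagonal(2)[OF cring_int_ring GL(1)[OF assms]]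
      GL_upper_triangular_diagonal(2)[OF cring_int_ring GL(2)[OF assms]] s
    by (simp_all add: int_ring_Units_iff)
  show "nrm (\<omega> g) = 1"
    using GL_upper_triangular_diagonal(1)[OF cring_int_ring GL(1)[OF assms]] s 1
    by (simp add: int_ring_Units_iff mult)
qed

text \<open>The parameters \<open>\<beta>1\<close> and \<open>\<beta>2\<close> may fail to be
  integral. Their multiples by \<open>1 - \<omega> g\<close> are, up to a unit, corner entries minus
  integral terms.\<close>

lemma offset_integral:
  assumes g: "g \<in> carrier G"
  shows "nrm (\<beta>1 * (1 - \<omega> g)) \<le> 1" "nrm (\<beta>2 * (1 - \<omega> g)) \<le> 1"
proof -
  obtain s where s: "nrm s \<le> 1"
    "\<rho>1 g $ 1 $ 2 = \<alpha>1 * s * (\<eta> g * \<omega> g) + \<beta>1 * (\<eta> g - \<eta> g * \<omega> g)"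
    "\<rho>2 g $ 1 $ 2 = \<alpha>2 * s * (\<theta> g * \<omega> g) + \<beta>2 * (\<theta> g - \<theta> g * \<omega> g)"
    by (rule shape_nth[OF g])
  have "nrm (\<rho>1 g $ 1 $ 2 - \<alpha>1 * s * (\<eta> g * \<omega> g)) \<le> 1"
    "nrm (\<rho>2 g $ 1 $ 2 - \<alpha>2 * s * (\<theta> g * \<omega> g)) \<le> 1"
    using s(1) entries[OF g] by (auto intro!: diff_le simp: mult unit character_units[OF g])
  moreover have "\<rho>1 g $ 1 $ 2 - \<alpha>1 * s * (\<eta> g * \<omega> g) = \<eta> g * (\<beta>1 * (1 - \<omega> g))"
    "\<rho>2 g $ 1 $ 2 - \<alpha>2 * s * (\<theta> g * \<omega> g) = \<theta> g * (\<beta>2 * (1 - \<omega> g))"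
    by (simp_all add: s algebra_simps)
  ultimately show "nrm (\<beta>1 * (1 - \<omega> g)) \<le> 1" "nrm (\<beta>2 * (1 - \<omega> g)) \<le> 1"
    by (simp_all add: mult[of "\<eta> g"] mult[of "\<theta> g"] character_units[OF g])
qed

section \<open>Necessity of the two conditions\<close>

lemma reduced_rep_iso_imp:
  assumes "rep_isomorphic G (residue_ring nrm L) (reduced_rep nrm L \<rho>1) (reduced_rep nrm L \<rho>2)"
  shows "\<forall>g\<in>carrier G. nrm (\<eta> g - \<theta> g) < 1" "nrm \<gamma> \<le> 1 \<or> nrm (\<gamma> * h) < 1"
proof -
  obtain Q where Q: "Q \<in> carrier (GL (residue_ring nrm L))"
    "\<And>g. g \<in> carrier G \<Longrightarrow> Q \<otimes>\<^bsub>mat_monoid (residue_ring nrm L)\<^esub> reduced_rep nrm L \<rho>1 g =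
        reduced_rep nrm L \<rho>2 g \<otimes>\<^bsub>mat_monoid (residue_ring nrm L)\<^esub> Q"
    using assms by (auto simp: rep_isomorphic_def)
  obtain P :: "'a ^ 2 ^ 2" where P: "\<And>i j. P $ i $ j \<in> L" "\<And>i j. nrm (P $ i $ j) \<le> 1"
    "Q = (\<chi> i j. reduction nrm L (P $ i $ j))"
    using reduced_matrix_lift[of Q] GL_carrierD[OF Q(1)] by metis
  define x y z w where "x = P $ 1 $ 1" and "y = P $ 1 $ 2" and "z = P $ 2 $ 1" and "w = P $ 2 $ 2"
  note xyzw_def = x_def y_def z_def w_def
  have le: "nrm x \<le> 1" "nrm y \<le> 1" "nrm z \<le> 1" "nrm w \<le> 1"
    by (simp_all add: xyzw_def P)
  have intertwine: "nrm ((P $ i $ 1 * \<rho>1 g $ 1 $ j + P $ i $ 2 * \<rho>1 g $ 2 $ j) -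
      (\<rho>2 g $ i $ 1 * P $ 1 $ j + \<rho>2 g $ i $ 2 * P $ 2 $ j)) < 1" if "g \<in> carrier G" for g i j
    using Q(2)[OF that] reduced_conjugation_iff[of "\<rho>1 g" "\<rho>2 g" P] entries[OF that] P(1,2)
    unfolding P(3) reduced_rep_def by blast
  define c d where "c = \<eta> u" and "d = \<theta> u"
  have cd: "nrm c = 1" "nrm d = 1"
    using character_units[OF u(1)] by (simp_all add: c_def d_def)
  \<comment> \<open>At \<open>u\<close> the value 1 in place of \<open>\<omega>\<close> removes the
    \<open>\<beta>\<close> terms.\<close>
  have u12: "nrm ((x * (\<alpha>1 * c) + y * c) - (d * y + \<alpha>2 * d * w)) < 1"
    using intertwine[OF u(1), of 1 2] by (simp add: u M_nth flip: xyzw_def c_def d_def)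
  have u21: "nrm (z * c - d * z) < 1"
    using intertwine[OF u(1), of 2 1] by (simp add: u M_nth flip: xyzw_def c_def d_def)
  have u22: "nrm ((z * (\<alpha>1 * c) + w * c) - d * w) < 1"
    using intertwine[OF u(1), of 2 2] by (simp add: u M_nth flip: xyzw_def c_def d_def)
  \<comment> \<open>If \<open>z\<close> were a unit, the (2,1) entry would make \<open>c\<close> and
    \<open>d\<close> congruent, and the (2,2) entry would then leave the unit
    \<open>z * \<alpha>1 * c\<close>.\<close>
  have z: "nrm z < 1"
  proof (rule ccontr)
    assume "\<not> nrm z < 1"
    hence z1: "nrm z = 1" using le by simp
    have "nrm (z * (c - d)) < 1"
      using u21 by (simp add: algebra_simps)
    hence "nrm (c - d) < 1"
      by (simp add: mult z1)
    hence "nrm (w * (c - d)) < 1"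
      using mult_less_1' le by simp
    hence "nrm (((z * (\<alpha>1 * c) + w * c) - d * w) - w * (c - d)) < 1"
      using diff_less u22 by blast
    moreover have "((z * (\<alpha>1 * c) + w * c) - d * w) - w * (c - d) = z * \<alpha>1 * c"
      by (simp add: algebra_simps)
    ultimately show False
      by (simp add: mult z1 unit cd)
  qed
  have "Q $ 2 $ 1 = \<zero>\<^bsub>residue_ring nrm L\<^esub>"
    using reduction_eq_iff[of z 0] P(1) z le L_closed(1) by (simp add: P(3) residue_ring_zero xyzw_def)
  hence xw: "nrm x = 1" "nrm w = 1"
    using GL_upper_triangular_diagonal[OF cring_residue_ring Q(1)] reduction_Units_iff P(1,2)
    by (simp_all add: P(3) xyzw_def)
  show cong: "\<forall>g\<in>carrier G. nrm (\<eta> g - \<theta> g) < 1"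
  proof
    fix g assume g: "g \<in> carrier G"
    obtain s where s: "\<rho>1 g $ 2 $ 2 = \<eta> g" "\<rho>2 g $ 2 $ 1 = 0" "\<rho>2 g $ 2 $ 2 = \<theta> g"
      by (rule shape_nth[OF g])
    have "nrm (z * \<rho>1 g $ 1 $ 2 + w * \<eta> g - \<theta> g * w) < 1"
      using intertwine[OF g, of 2 2] by (simp add: s flip: xyzw_def)
    moreover have "nrm (z * \<rho>1 g $ 1 $ 2) < 1"
      using mult_less_1 z entries(2)[OF g] by simp
    ultimately have "nrm ((z * \<rho>1 g $ 1 $ 2 + w * \<eta> g - \<theta> g * w) - z * \<rho>1 g $ 1 $ 2) < 1"
      using diff_less by blast
    moreover have "(z * \<rho>1 g $ 1 $ 2 + w * \<eta> g - \<theta> g * w) - z * \<rho>1 g $ 1 $ 2 = w * (\<eta> g - \<theta> g)"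
      by (simp add: algebra_simps)
    ultimately show "nrm (\<eta> g - \<theta> g) < 1"
      by (simp add: mult xw)
  qed
  have xw_cong: "nrm (x * \<alpha>1 - \<alpha>2 * w) < 1"
  proof -
    \<comment> \<open>Replacing \<open>d\<close> by the congruent \<open>c\<close> in the corner
      entry cancels \<open>y\<close> and leaves a unit times the claim.\<close>
    have "nrm ((c - d) * (y + \<alpha>2 * w)) < 1"
      using cong u(1) le unit add_le[of y 1 "\<alpha>2 * w"]
      by (intro mult_less_1) (auto simp: mult c_def d_def)
    hence "nrm (((x * (\<alpha>1 * c) + y * c) - (d * y + \<alpha>2 * d * w)) - (c - d) * (y + \<alpha>2 * w)) < 1"
      using diff_less u12 by blast
    moreover have "((x * (\<alpha>1 * c) + y * c) - (d * y + \<alpha>2 * d * w)) - (c - d) * (y + \<alpha>2 * w) =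
        c * (x * \<alpha>1 - \<alpha>2 * w)"
      by (simp add: algebra_simps)
    ultimately show ?thesis
      by (simp add: mult cd)
  qed
  define c' d' where "c' = \<eta> f" and "d' = \<theta> f"
  have cd': "nrm c' = 1" "nrm d' = 1" "nrm (\<omega> f) = 1" "nrm (c' - d') < 1"
    using character_units[OF f(1)] cong f(1) by (simp_all add: c'_def d'_def)
  have \<beta>h: "nrm (\<beta>1 * h) \<le> 1" "nrm (\<beta>2 * h) \<le> 1"
    using offset_integral[OF f(1)] by (simp_all add: h_def)
  have f12: "nrm ((x * (\<beta>1 * (c' - c' * \<omega> f)) + y * c') -
      (d' * \<omega> f * y + \<beta>2 * (d' - d' * \<omega> f) * w)) < 1" (is "nrm ?e < 1")
    using intertwine[OF f(1), of 1 2] by (simp add: f M_nth flip: xyzw_def c'_def d'_def)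
  \<comment> \<open>Multiplication by \<open>\<alpha>2\<close> prepares two replacements modulo
    small terms: \<open>d'\<close> by \<open>c'\<close>, and \<open>\<alpha>2 * w\<close> by
    \<open>x * \<alpha>1\<close>. What remains is the combination that contains
    \<open>\<gamma>\<close>.\<close>
  have "nrm (\<alpha>2 * ?e) < 1"
    using f12 unit by (simp add: mult)
  moreover have "nrm (\<omega> f * y + \<beta>2 * h * w) \<le> 1"
    using cd' le \<beta>h by (intro add_le mult_le_1[of _ y] mult_le_1[of _ w]) auto
  hence "nrm ((c' - d') * (\<alpha>2 * (\<omega> f * y + \<beta>2 * h * w))) < 1"
    using cd' unit by (intro mult_less_1 mult_le_1[of \<alpha>2]) auto
  moreover have "nrm (c' * (\<beta>2 * h) * (x * \<alpha>1 - \<alpha>2 * w)) < 1"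
    using xw_cong \<beta>h cd' by (intro mult_less_1' mult_le_1[of c']) auto
  ultimately have "nrm (\<alpha>2 * ?e - (c' - d') * (\<alpha>2 * (\<omega> f * y + \<beta>2 * h * w)) -
      c' * (\<beta>2 * h) * (x * \<alpha>1 - \<alpha>2 * w)) < 1"
    by (intro diff_less)
  moreover have "\<alpha>1 \<noteq> 0"
    using unit by auto
  hence "\<alpha>2 * ?e - (c' - d') * (\<alpha>2 * (\<omega> f * y + \<beta>2 * h * w)) - c' * (\<beta>2 * h) * (x * \<alpha>1 - \<alpha>2 * w) =
      c' * ((x * \<alpha>1 * \<gamma> + \<alpha>2 * y) * h)"
    by (simp add: h_def \<gamma>_def field_simps)
  ultimately have main: "nrm ((x * \<alpha>1 * \<gamma> + \<alpha>2 * y) * h) < 1"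
    by (simp add: mult[of c'] cd')
  show "nrm \<gamma> \<le> 1 \<or> nrm (\<gamma> * h) < 1"
  \<comment> \<open>If \<open>\<gamma> * h\<close> is not small, cancelling \<open>h\<close> shows
    that \<open>\<alpha>2 * y\<close> cancels the leading part of
    \<open>x * \<alpha>1 * \<gamma>\<close>; so \<open>\<gamma>\<close> is no larger than the
    integral \<open>\<alpha>2 * y\<close>.\<close>
  proof (rule disjCI)
    assume "\<not> nrm (\<gamma> * h) < 1"
    hence "nrm ((x * \<alpha>1 * \<gamma> + \<alpha>2 * y) * h) < nrm (\<gamma> * h)"
      using main by linarith
    hence "nrm (x * \<alpha>1 * \<gamma> + \<alpha>2 * y) < nrm \<gamma>"
      using nonneg[of h] by (simp add: mult mult_less_cancel_right)
    moreover have "nrm (\<alpha>2 * y) \<le> 1" "nrm (x * \<alpha>1 * \<gamma>) = nrm \<gamma>"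
      using le unit xw by (simp_all add: mult)
    ultimately show "nrm \<gamma> \<le> 1"
      using diff_less[of "x * \<alpha>1 * \<gamma> + \<alpha>2 * y" "nrm \<gamma>" "\<alpha>2 * y"] by fastforce
  qed
qed

section \<open>Sufficiency, by an explicit intertwining matrix\<close>

lemma reduced_rep_iso_if:
  assumes cong: "\<forall>g\<in>carrier G. nrm (\<eta> g - \<theta> g) < 1" and \<gamma>: "nrm \<gamma> \<le> 1 \<or> nrm (\<gamma> * h) < 1"
  shows "rep_isomorphic G (residue_ring nrm L) (reduced_rep nrm L \<rho>1) (reduced_rep nrm L \<rho>2)"
proof -
  have ne: "\<alpha>1 \<noteq> 0" "\<alpha>2 \<noteq> 0"
    using unit by auto
  \<comment> \<open>With \<open>x = 1\<close> this solves the diagonal condition exactly. The corner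
    condition becomes \<open>(w * \<gamma> + y) * h\<close> small: \<open>y\<close> kills the
    bracket if \<open>\<gamma>\<close> is integral, and otherwise \<open>y = 0\<close>
    suffices.\<close>
  define w where "w = \<alpha>1 / \<alpha>2"
  define y where "y = (if nrm \<gamma> \<le> 1 then - (w * \<gamma>) else 0)"
  have w: "w \<in> L" "nrm w = 1"
    using in_L unit L_closed(8) by (simp_all add: w_def nrm_divide)
  have "\<gamma> \<in> L"
    using in_L L_closed by (simp add: \<gamma>_def)
  hence y: "y \<in> L" "nrm y \<le> 1"
    using w L_closed by (simp_all add: y_def mult)
  have \<delta>: "nrm ((w * \<gamma> + y) * h) < 1"
    using \<gamma> w by (auto simp: y_def mult)
  define P where "P = mat2 1 y 0 w"
  have P: "P $ i $ j \<in> L" "nrm (P $ i $ j) \<le> 1" for i j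
  proof -
    have "\<forall>i j. P $ i $ j \<in> L \<and> nrm (P $ i $ j) \<le> 1"
      unfolding forall_2 using y w L_closed(1,2) by (simp add: P_def)
    thus "P $ i $ j \<in> L" "nrm (P $ i $ j) \<le> 1" by auto
  qed
  define Q :: "'a set ^ 2 ^ 2" where "Q = (\<chi> i j. reduction nrm L (P $ i $ j))"
  have "Q \<in> carrier (GL (residue_ring nrm L))"
  proof (rule GL_upper_triangularI[OF cring_residue_ring])
    show "Q $ 1 $ 1 \<in> Units (residue_ring nrm L)" "Q $ 2 $ 2 \<in> Units (residue_ring nrm L)"
      using w L_closed(2) by (simp_all add: Q_def P_def reduction_Units_iff)
    show "Q $ 1 $ 2 \<in> carrier (residue_ring nrm L)"
      using y by (simp add: Q_def P_def residue_ring_carrier)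
    show "Q $ 2 $ 1 = \<zero>\<^bsub>residue_ring nrm L\<^esub>"
      by (simp add: Q_def P_def residue_ring_zero)
  qed
  moreover have "Q \<otimes>\<^bsub>mat_monoid (residue_ring nrm L)\<^esub> reduced_rep nrm L \<rho>1 g =
        reduced_rep nrm L \<rho>2 g \<otimes>\<^bsub>mat_monoid (residue_ring nrm L)\<^esub> Q" if g: "g \<in> carrier G" for g
  proof -
    obtain s where s: "nrm s \<le> 1"
      "\<rho>1 g $ 1 $ 1 = \<eta> g * \<omega> g" "\<rho>1 g $ 2 $ 1 = 0" "\<rho>1 g $ 2 $ 2 = \<eta> g"
      "\<rho>1 g $ 1 $ 2 = \<alpha>1 * s * (\<eta> g * \<omega> g) + \<beta>1 * (\<eta> g - \<eta> g * \<omega> g)"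
      "\<rho>2 g $ 1 $ 1 = \<theta> g * \<omega> g" "\<rho>2 g $ 2 $ 1 = 0" "\<rho>2 g $ 2 $ 2 = \<theta> g"
      "\<rho>2 g $ 1 $ 2 = \<alpha>2 * s * (\<theta> g * \<omega> g) + \<beta>2 * (\<theta> g - \<theta> g * \<omega> g)"
      by (rule shape_nth[OF g])
    define c d o' where "c = \<eta> g" and "d = \<theta> g" and "o' = \<omega> g"
    have small: "nrm (c - d) < 1" and units: "nrm c = 1" "nrm d = 1" "nrm o' = 1"
      using cong g character_units[OF g] by (simp_all add: c_def d_def o'_def)
    \<comment> \<open>This bound carries the corner condition from the Frobenius element to every
      \<open>g\<close>.\<close>
    have "nrm (1 - o') \<le> nrm h"
      using \<omega>_le[OF g] by (simp add: o'_def)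
    hence "nrm ((w * \<gamma> + y) * (1 - o')) \<le> nrm ((w * \<gamma> + y) * h)"
      using nonneg by (simp add: mult mult_left_mono)
    hence "nrm (c * ((w * \<gamma> + y) * (1 - o'))) < 1"
      using \<delta> by (simp add: mult[of c] units)
    moreover have "nrm (w * (\<beta>2 * (1 - o'))) \<le> 1"
      using offset_integral(2)[OF g] w(2) by (intro mult_le_1[of w]) (simp_all add: o'_def)
    hence "nrm ((c - d) * (\<alpha>1 * s * o' + y * o' + w * (\<beta>2 * (1 - o')))) < 1"
      using small y(2) units s(1) unit by (intro mult_less_1 add_le) (simp_all add: mult)
    ultimately have "nrm ((c - d) * (\<alpha>1 * s * o' + y * o' + w * (\<beta>2 * (1 - o'))) +
        c * ((w * \<gamma> + y) * (1 - o'))) < 1"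
      by (intro add_less)
    \<comment> \<open>The corner defect splits into a part from the congruent characters and a part
      governed by \<open>\<gamma>\<close>; the \<open>s\<close> terms match because
      \<open>\<alpha>2 * w = \<alpha>1\<close>.\<close>
    moreover have "(c - d) * (\<alpha>1 * s * o' + y * o' + w * (\<beta>2 * (1 - o'))) +
        c * ((w * \<gamma> + y) * (1 - o')) =
        ((\<alpha>1 * s * (c * o') + \<beta>1 * (c - c * o')) + y * c) -
        (d * o' * y + (\<alpha>2 * s * (d * o') + \<beta>2 * (d - d * o')) * w)"
      using ne by (simp add: w_def \<gamma>_def field_simps)
    ultimately have e12: "nrm (((\<alpha>1 * s * (c * o') + \<beta>1 * (c - c * o')) + y * c) -
        (d * o' * y + (\<alpha>2 * s * (d * o') + \<beta>2 * (d - d * o')) * w)) < 1"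
      by simp
    have "nrm ((c - d) * o') < 1" "nrm ((c - d) * w) < 1"
      using small units w by (simp_all add: mult)
    hence e: "nrm (c * o' - d * o') < 1" "nrm (w * c - d * w) < 1"
      by (simp_all add: algebra_simps)
    have "\<forall>i j. nrm ((P $ i $ 1 * \<rho>1 g $ 1 $ j + P $ i $ 2 * \<rho>1 g $ 2 $ j) -
                     (\<rho>2 g $ i $ 1 * P $ 1 $ j + \<rho>2 g $ i $ 2 * P $ 2 $ j)) < 1"
      unfolding forall_2 s(2-) using e e12 by (simp add: P_def flip: c_def d_def o'_def)
    thus ?thesis
      using reduced_conjugation_iff[of "\<rho>1 g" "\<rho>2 g" P] entries[OF g] P
      unfolding Q_def reduced_rep_def by blast
  qed
  ultimately show ?thesis
    unfolding rep_isomorphic_def by blast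
qed

lemma reduced_rep_iso_iff:
  "rep_isomorphic G (residue_ring nrm L) (reduced_rep nrm L \<rho>1) (reduced_rep nrm L \<rho>2) \<longleftrightarrow>
     (\<forall>g\<in>carrier G. nrm (\<eta> g - \<theta> g) < 1) \<and> (nrm \<gamma> \<le> 1 \<or> nrm (\<gamma> * h) < 1)"
  using reduced_rep_iso_imp reduced_rep_iso_if by blast

end

end

theorem proposition3p12:
  fixes p l i :: nat
    and nF :: "'f::{alg_closed_field, field_char_0} \<Rightarrow> real" and F :: "'f set"
    and nK :: "'k::{alg_closed_field, field_char_0} \<Rightarrow> real" and K :: "'k set"
    and v :: "'k \<Rightarrow> ereal"
    and \<Phi> :: "'f \<Rightarrow> 'f"
    and \<omega> t chi theta :: "('f \<Rightarrow> 'f) \<Rightarrow> 'k"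
    and \<rho>1 \<rho>2 :: "('f \<Rightarrow> 'f) \<Rightarrow> 'k ^ 2 ^ 2"
    and a1 b1 d1 a2 b2 d2 :: 'k
  defines "W \<equiv> weil_group nF F"
  assumes "Factorial_Ring.prime p" and "odd p" and "Factorial_Ring.prime l" and "odd l" and "p \<noteq> l"
    and "padic_closure p nF" and "finite_padic_extension nF F"
    and "padic_closure l nK" and "finite_padic_extension nK K"
    and "normalized_valuation nK K v"
    and "frobenius_element nF F \<Phi>"
    and "weil_omega nF F \<Phi> \<omega>"
    and "tame_character nF F nK \<omega> t"
    and "special nF F nK \<Phi> \<omega> t \<rho>1" and "special nF F nK \<Phi> \<omega> t \<rho>2"
    and "\<rho>1 ` carrier W \<subseteq> carrier (GL (int_ring nK K))"
    and "\<rho>2 ` carrier W \<subseteq> carrier (GL (int_ring nK K))"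
    and "special_with_character nF F nK \<Phi> \<omega> t \<rho>1 chi"
    and "special_with_character nF F nK \<Phi> \<omega> t \<rho>2 theta"
    and "mat2 a1 b1 0 d1 \<in> carrier (GL (ring_of_type_algebra\<lparr>carrier := K\<rparr>))"
    and "mat2 a2 b2 0 d2 \<in> carrier (GL (ring_of_type_algebra\<lparr>carrier := K\<rparr>))"
    and "\<And>(k::int) \<tau> g. \<tau> \<in> inertia nF F \<Longrightarrow> g = \<Phi> [^]\<^bsub>W\<^esub> k \<otimes>\<^bsub>W\<^esub> \<tau> \<Longrightarrow>
           \<rho>1 g = mat2 (chi g * \<omega> g)
                       (a1 / d1 * t \<tau> * (chi g * \<omega> g) + b1 / d1 * (chi g - chi g * \<omega> g))
                       0
                       (chi g)"
    and "\<And>(k::int) \<tau> g. \<tau> \<in> inertia nF F \<Longrightarrow> g = \<Phi> [^]\<^bsub>W\<^esub> k \<otimes>\<^bsub>W\<^esub> \<tau> \<Longrightarrow>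
           \<rho>2 g = mat2 (theta g * \<omega> g)
                       (a2 / d2 * t \<tau> * (theta g * \<omega> g) + b2 / d2 * (theta g - theta g * \<omega> g))
                       0
                       (theta g)"
    and "a1 / d1 \<in> Units (int_ring nK K)" and "a2 / d2 \<in> Units (int_ring nK K)"
    and "of_nat (residue_card nF F) - 1 \<in> max_ideal_power nK K i"
    and "\<And>j. of_nat (residue_card nF F) - 1 \<in> max_ideal_power nK K j \<Longrightarrow> j \<le> i"
  shows "rep_isomorphic W (residue_ring nK K) (reduced_rep nK K \<rho>1) (reduced_rep nK K \<rho>2) \<longleftrightarrow>
         (\<forall>g\<in>carrier W. reduction nK K (chi g) = reduction nK K (theta g)) \<and>
         v ((a2 * b1 - a1 * b2) / (a1 * d2)) \<ge> ereal (of_int (min 0 (1 - int i)))"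
proof -
  interpret NF: nonarchimedean_field nF
    by (rule padic_closure_nonarchimedean) fact
  interpret NK: nonarchimedean_field nK
    by (rule padic_closure_nonarchimedean) fact
  interpret K: valued_subfield nK K
    using NK.nonarchimedean_field_axioms \<open>finite_padic_extension nK K\<close>
    by (simp add: valued_subfield_def valued_subfield_axioms_def finite_padic_extension_def)
  note frob = \<open>frobenius_element nF F \<Phi>\<close>
  note tame = \<open>tame_character nF F nK \<omega> t\<close>
  note v = \<open>normalized_valuation nK K v\<close>
  note GL1 = \<open>\<rho>1 ` carrier W \<subseteq> carrier (GL (int_ring nK K))\<close>
  note GL2 = \<open>\<rho>2 ` carrier W \<subseteq> carrier (GL (int_ring nK K))\<close>
  note shape1 = assms(23) and shape2 = assms(24)
  define q :: 'k where "q = of_nat (residue_card nF F)"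
  define \<gamma> where "\<gamma> = a2 / d2 * (b1 / d1) / (a1 / d1) - b2 / d2"
  define h where "h = 1 - \<omega> \<Phi>"

  have upper: "a \<in> K - {0} \<and> b \<in> K \<and> d \<in> K - {0}"
    if "mat2 a b 0 d \<in> carrier (GL (ring_of_type_algebra\<lparr>carrier := K\<rparr>))" for a b d
  proof -
    have "cring (ring_of_type_algebra\<lparr>carrier := K\<rparr>)"
      using ring.subfield_iff(2)[OF ring_from_type_algebra K.subfield] by (simp add: field_def domain_def)
    from GL_upper_triangular_diagonal[OF this that] GL_carrierD[OF that, of 1 2] show ?thesis
      using subfield.subfield_Units[OF K.subfield] by simp
  qed
  have abd: "a1 \<in> K" "a1 \<noteq> 0" "b1 \<in> K" "d1 \<in> K" "d1 \<noteq> 0" "a2 \<in> K" "a2 \<noteq> 0" "b2 \<in> K" "d2 \<in> K" "d2 \<noteq> 0"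
    using upper assms(21,22) by auto
  have \<alpha>: "nK (a1 / d1) = 1" "nK (a2 / d2) = 1"
    using assms(25,26) by (simp_all add: K.int_ring_Units_iff)
  have in_K: "a1 / d1 \<in> K" "a2 / d2 \<in> K" "b1 / d1 \<in> K" "b2 / d2 \<in> K"
    using abd K.L_closed(8) by blast+
  have \<gamma>: "\<gamma> \<in> K" "(a2 * b1 - a1 * b2) / (a1 * d2) = \<gamma>"
  proof -
    show "\<gamma> \<in> K"
      unfolding \<gamma>_def by (intro K.L_closed(4,6,8) abd)
    show "(a2 * b1 - a1 * b2) / (a1 * d2) = \<gamma>"
      using abd by (simp add: \<gamma>_def field_simps)
  qed

  \<comment> \<open>The two test elements and the values of \<open>t\<close> and
    \<open>\<omega>\<close> on them\<close>
  have integral_t: "nK (t \<tau>) \<le> 1" if "\<tau> \<in> inertia nF F" for \<tau>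
    using tame that by (auto simp: tame_character_def int_ring_def)
  have "1 \<in> carrier (int_ring nK (rat_closure nK))"
    using range_of_rat_subset_rat_closure[OF NK.nonarchimedean_field_axioms] of_rat_1[where 'a = 'k]
    by (auto simp: int_ring_def dest: subsetD[OF _ rangeI[of of_rat 1]])
  then obtain \<tau>1 where \<tau>1: "\<tau>1 \<in> inertia nF F" "t \<tau>1 = 1"
    using tame unfolding tame_character_def by (metis imageE)
  have t_id: "t id = 0"
    using tame NF.id_in_inertia[of F] unfolding tame_character_def
    by (metis add_cancel_right_right comp_id weil_group_simps(1))
  have \<omega>: "\<omega> (\<Phi> [^]\<^bsub>W\<^esub> k \<otimes>\<^bsub>W\<^esub> \<tau>) = q powi (- k)" if "\<tau> \<in> inertia nF F" for k :: int and \<tau>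
    using \<open>weil_omega nF F \<Phi> \<omega>\<close> that by (simp add: weil_omega_def W_def q_def)
  \<comment> \<open>The given matrix formulas apply only to elements written as a Frobenius power
    times inertia; here the exponents are 1 and 0.\<close>
  have decomp\<Phi>: "\<Phi> = \<Phi> [^]\<^bsub>W\<^esub> (1 :: int) \<otimes>\<^bsub>W\<^esub> id"
    using int_pow_int[of W \<Phi> 1] by (simp add: W_def weil_group_nat_pow)
  have decomp\<tau>1: "\<tau>1 = \<Phi> [^]\<^bsub>W\<^esub> (0 :: int) \<otimes>\<^bsub>W\<^esub> \<tau>1"
    using int_pow_int[of W \<Phi> 0] by (simp add: W_def weil_group_nat_pow)
  have \<omega>\<Phi>: "\<omega> \<Phi> = inverse q"
    using \<omega>[OF NF.id_in_inertia, of 1] decomp\<Phi> by simp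
  have \<omega>\<tau>1: "\<omega> \<tau>1 = 1"
    using \<omega>[OF \<tau>1(1), of 0] decomp\<tau>1 by simp
  have mem: "\<Phi> \<in> carrier W" "\<tau>1 \<in> carrier W"
    using frob \<tau>1(1) inertia_subset_weil_group by (auto simp: frobenius_element_def W_def)

  have shape\<Phi>: "\<rho>1 \<Phi> = mat2 (chi \<Phi> * \<omega> \<Phi>)
      (a1 / d1 * 0 * (chi \<Phi> * \<omega> \<Phi>) + b1 / d1 * (chi \<Phi> - chi \<Phi> * \<omega> \<Phi>)) 0 (chi \<Phi>)"
    "\<rho>2 \<Phi> = mat2 (theta \<Phi> * \<omega> \<Phi>)
      (a2 / d2 * 0 * (theta \<Phi> * \<omega> \<Phi>) + b2 / d2 * (theta \<Phi> - theta \<Phi> * \<omega> \<Phi>)) 0 (theta \<Phi>)"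
    using shape1[OF NF.id_in_inertia decomp\<Phi>] shape2[OF NF.id_in_inertia decomp\<Phi>]
    by (simp_all only: t_id)
  have shape\<tau>1: "\<rho>1 \<tau>1 = mat2 (chi \<tau>1 * 1)
      (a1 / d1 * 1 * (chi \<tau>1 * 1) + b1 / d1 * (chi \<tau>1 - chi \<tau>1 * 1)) 0 (chi \<tau>1)"
    "\<rho>2 \<tau>1 = mat2 (theta \<tau>1 * 1)
      (a2 / d2 * 1 * (theta \<tau>1 * 1) + b2 / d2 * (theta \<tau>1 - theta \<tau>1 * 1)) 0 (theta \<tau>1)"
    using shape1[OF \<tau>1(1) decomp\<tau>1] shape2[OF \<tau>1(1) decomp\<tau>1]
    by (simp_all only: \<tau>1 \<omega>\<tau>1)

  \<comment> \<open>The diagonal of this integral invertible matrix shows that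
    \<open>\<omega> \<Phi> = inverse q\<close> is a unit.\<close>
  have "\<rho>1 \<Phi> \<in> carrier (GL (int_ring nK K))"
    using GL1 mem by blast
  hence "nK (chi \<Phi> * \<omega> \<Phi>) = 1" "nK (chi \<Phi>) = 1"
    using GL_upper_triangular_diagonal[OF K.cring_int_ring, of "\<rho>1 \<Phi>"]
    by (simp_all add: shape\<Phi> K.int_ring_Units_iff)
  hence \<omega>_unit: "nK (\<omega> \<Phi>) = 1"
    by (simp add: NK.mult)
  hence q: "q \<noteq> 0" "nK (inverse q) = 1"
    by (auto simp: \<omega>\<Phi>)

  have "v (q - 1) = ereal (of_nat i)"
    using K.valuation_eqI[OF v] assms(27,28) by (simp add: q_def)
  moreover have qK: "q - 1 \<in> K"
    using assms(27) K.max_ideal_power_iff[OF v] by (simp add: q_def)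
  moreover have inv_qK: "inverse q \<in> K"
    using K.L_closed(2,3,7) qK by (metis diff_add_cancel)
  \<comment> \<open>As \<open>q\<close> is a unit, \<open>h\<close> has the same valuation as
    \<open>q - 1\<close>, namely \<open>i\<close>.\<close>
  moreover have h_eq: "h = (q - 1) * inverse q"
    using q(1) by (simp add: h_def \<omega>\<Phi> field_simps)
  ultimately have vh: "v h = ereal (of_nat i)"
    using K.valuation_mult[OF v qK inv_qK] K.valuation_eq_0[OF v inv_qK q(2)] by simp
  have hK: "h \<in> K"
    using h_eq K.L_closed(4)[OF qK inv_qK] by simp

  have \<omega>_le: "nK (1 - \<omega> g) \<le> nK (1 - \<omega> \<Phi>)" if g: "g \<in> carrier W" for g
  proof -
    obtain k :: int and \<tau> where "\<tau> \<in> inertia nF F" "g = \<Phi> [^]\<^bsub>W\<^esub> k \<otimes>\<^bsub>W\<^esub> \<tau>"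
      by (rule NF.weil_group_decomposition[OF frob g[unfolded W_def], folded W_def])
    hence "\<omega> g = (\<omega> \<Phi>) powi k"
      using \<omega> by (simp add: \<omega>\<Phi> power_int_minus power_int_inverse)
    thus ?thesis
      using NK.one_minus_powi_le[OF \<omega>_unit] by simp
  qed
  \<comment> \<open>One decomposition of \<open>g\<close> serves both representations, so they share
    the parameter \<open>s = t \<tau>\<close>.\<close>
  have shape: "\<exists>s. nK s \<le> 1 \<and>
      \<rho>1 g = mat2 (chi g * \<omega> g) (a1 / d1 * s * (chi g * \<omega> g) + b1 / d1 * (chi g - chi g * \<omega> g)) 0 (chi g) \<and>
      \<rho>2 g = mat2 (theta g * \<omega> g) (a2 / d2 * s * (theta g * \<omega> g) + b2 / d2 * (theta g - theta g * \<omega> g)) 0 (theta g)"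
    if g: "g \<in> carrier W" for g
  proof -
    obtain k :: int and \<tau> where "\<tau> \<in> inertia nF F" "g = \<Phi> [^]\<^bsub>W\<^esub> k \<otimes>\<^bsub>W\<^esub> \<tau>"
      by (rule NF.weil_group_decomposition[OF frob g[unfolded W_def], folded W_def])
    thus ?thesis
      using shape1[of \<tau> g k] shape2[of \<tau> g k] integral_t[of \<tau>] by (intro exI[of _ "t \<tau>"]) simp
  qed
  have GL: "\<rho>1 g \<in> carrier (GL (int_ring nK K))" "\<rho>2 g \<in> carrier (GL (int_ring nK K))"
    if "g \<in> carrier W" for g
    using GL1 GL2 that by auto
  note hyps = GL shape mem(2) shape\<tau>1 mem(1) shape\<Phi> \<omega>_le in_K(1,2,3,4) \<alpha>
  have char: "chi g \<in> K" "nK (chi g) \<le> 1" "theta g \<in> K" "nK (theta g) \<le> 1" if g: "g \<in> carrier W" for g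
  proof -
    have "chi g = \<rho>1 g $ 2 $ 2" "theta g = \<rho>2 g $ 2 $ 2"
      using shape[OF g] by auto
    thus "chi g \<in> K" "nK (chi g) \<le> 1" "theta g \<in> K" "nK (theta g) \<le> 1"
      using K.GL_int_ring_entry GL[OF g] by auto
  qed
  have "rep_isomorphic W (residue_ring nK K) (reduced_rep nK K \<rho>1) (reduced_rep nK K \<rho>2) \<longleftrightarrow>
      (\<forall>g\<in>carrier W. nK (chi g - theta g) < 1) \<and> (nK \<gamma> \<le> 1 \<or> nK (\<gamma> * h) < 1)"
    unfolding \<gamma>_def h_def
    by (rule K.reduced_rep_iso_iff[where u = \<tau>1 and f = \<Phi>]) (fact hyps)+
  moreover have "(\<forall>g\<in>carrier W. nK (chi g - theta g) < 1) \<longleftrightarrow>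
      (\<forall>g\<in>carrier W. reduction nK K (chi g) = reduction nK K (theta g))"
    using K.reduction_eq_iff char by auto
  ultimately show ?thesis
    unfolding \<gamma>(2) K.valuation_ge_min_iff[OF v \<gamma>(1) hK vh] by simp
qed

end
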